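(* Let $P$ be a lattice $3$-polytope of size at least seven which is spiked with respect to a $2$-dimensional configuration $A'=\pi(P\cap\mathbb{Z}^3)\subseteq\mathbb{Z}^2$, and let $P':=\mathrm{conv}(A')$. Then one of the following holds: (1) $P'$ is the second dilation of a unimodular triangle; (2) $P'$ is a reflexive triangle and $A'$ consists of its three vertices together with its unique interior lattice point; (3) $A'=P'\cap\mathbb{Z}^2$ and $P'$ has exactly four lattice points on its boundary and exactly one in its interior.
   Context: A lattice polytope has vertices in $\mathbb{Z}^d$; its size is its number of lattice points. An affine functional $f$ is integer if $f(\mathbb{Z}^d)\subseteq\mathbb{Z}$. The width of a finite set or polytope $S$ is the minimum over non-constant integer affine functionals $f$ of $\max_S f-\min_S f$ ($0$ if $S$ is not full-dimensional). For a finite $A\subseteq\mathbb{Z}^d$ with $\mathrm{conv}(A)$ of width $>1$, a vertex $v$ of $\mathrm{conv}(A)$ is essential if $\mathrm{conv}(A\setminus\{v\})$ has width at most one; $A$ is quasi-minimal if at most one vertex is non-essential. A lattice polytope $P$ is quasi-minimal if $P\cap\mathbb{Z}^d$ is. A quasi-minimal lattice $3$-polytope $P$ is spiked with respect to $A'=\pi(P\cap\mathbb{Z}^3)$, where $\pi:\mathbb{R}^3\to\mathbb{R}^2$ is an affine map with $\pi(\mathbb{Z}^3)=\mathbb{Z}^2$, if every vertex of $\mathrm{conv}(A')$ has a unique preimage in $P\cap\mathbb{Z}^3$ and $\pi$ restricts to a bijection between the essential vertices of $P\cap\mathbb{Z}^3$ and those of $A'$ (computed in $\mathbb{Z}^2$).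 A unimodular triangle is a lattice triangle unimodularly equivalent to $\mathrm{conv}\{(0,0),(1,0),(0,1)\}$. A lattice polygon is reflexive iff it has exactly one interior lattice point. *)

theory Defs
  imports "HOL-Analysis.Analysis"
begin

definition int_lattice :: "(real^'n) set" where
  "int_lattice = {x. \<forall>i. x $ i \<in> \<int>}"

definition affine_map :: "('a::real_vector \<Rightarrow> 'b::real_vector) \<Rightarrow> bool" where
  "affine_map f \<longleftrightarrow> linear (\<lambda>x. f x - f 0)"

definition integer_functional :: "(real^'n \<Rightarrow> real) \<Rightarrow> bool" where
  "integer_functional f \<longleftrightarrow> affine_map f \<and> f ` int_lattice \<subseteq> \<int>"

text \<open>
  The width is only meant for finite sets and polytopes. There \<open>Sup\<close> and \<open>Inf\<close> over \<open>f ` S\<close> are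
  maximum and minimum, and for full-dimensional \<open>S\<close> the outer infimum is attained, because only
  finitely many linear parts of integer functionals have extent below a given bound on \<open>S\<close>.
\<close>

definition width :: "(real^'n) set \<Rightarrow> real" where
  "width S =
    (if aff_dim S = int CARD('n)
     then Inf {Sup (f ` S) - Inf (f ` S) | f. integer_functional f \<and> \<not> f constant_on UNIV}
     else 0)"

definition vertices :: "(real^'n) set \<Rightarrow> (real^'n) set" where
  "vertices P = {v. v extreme_point_of P}"

definition lattice_polytope :: "(real^'n) set \<Rightarrow> bool" where
  "lattice_polytope P \<longleftrightarrow> polytope P \<and> vertices P \<subseteq> int_lattice"

definition lattice_points :: "(real^'n) set \<Rightarrow> (real^'n) set" where
  "lattice_points P = P \<inter> int_lattice"

definition size_of :: "(real^'n) set \<Rightarrow> nat" where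
  "size_of P = card (lattice_points P)"

text \<open>
  The next notion is only meant for finite sets \<open>A\<close> of lattice points whose convex hull has width
  greater than one; this is part of \<open>quasi_minimal\<close> below.
\<close>

definition essential_vertices :: "(real^'n) set \<Rightarrow> (real^'n) set" where
  "essential_vertices A =
    {v \<in> vertices (convex hull A). width (convex hull (A - {v})) \<le> 1}"

definition quasi_minimal :: "(real^'n) set \<Rightarrow> bool" where
  "quasi_minimal A \<longleftrightarrow>
    finite A \<and> A \<subseteq> int_lattice \<and> width (convex hull A) > 1 \<and>
    card (vertices (convex hull A) - essential_vertices A) \<le> 1"

definition quasi_minimal_polytope :: "(real^'n) set \<Rightarrow> bool" where
  "quasi_minimal_polytope P \<longleftrightarrow> lattice_polytope P \<and> quasi_minimal (lattice_points P)"

definition lattice_projection :: "(real^'n \<Rightarrow> real^'m) \<Rightarrow> bool" where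
  "lattice_projection \<pi> \<longleftrightarrow> affine_map \<pi> \<and> \<pi> ` int_lattice = int_lattice"

text \<open>
  The essential vertices of \<open>A'\<close> below make sense: composing with \<open>\<pi>\<close> turns integer functionals on
  the plane into integer functionals on space, so \<open>convex hull A'\<close> inherits width greater than one
  from \<open>P\<close>.
\<close>

definition spiked_wrt :: "(real^3) set \<Rightarrow> (real^2) set \<Rightarrow> bool" where
  "spiked_wrt P A' \<longleftrightarrow>
    aff_dim P = 3 \<and> quasi_minimal_polytope P \<and>
    (\<exists>\<pi>. lattice_projection \<pi> \<and> A' = \<pi> ` lattice_points P \<and>
         (\<forall>v \<in> vertices (convex hull A'). \<exists>!x. x \<in> lattice_points P \<and> \<pi> x = v) \<and>
         bij_betw \<pi> (essential_vertices (lattice_points P)) (essential_vertices A'))"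

definition unimodularly_equivalent :: "(real^'n) set \<Rightarrow> (real^'n) set \<Rightarrow> bool" where
  "unimodularly_equivalent S T \<longleftrightarrow> (\<exists>\<phi>. lattice_projection \<phi> \<and> bij \<phi> \<and> \<phi> ` S = T)"

definition lattice_polygon :: "(real^2) set \<Rightarrow> bool" where
  "lattice_polygon P \<longleftrightarrow> lattice_polytope P \<and> aff_dim P = 2"

definition lattice_triangle :: "(real^2) set \<Rightarrow> bool" where
  "lattice_triangle T \<longleftrightarrow> lattice_polygon T \<and> card (vertices T) = 3"

definition unimodular_triangle :: "(real^2) set \<Rightarrow> bool" where
  "unimodular_triangle T \<longleftrightarrow>
    lattice_triangle T \<and>
    unimodularly_equivalent (convex hull {vector [0, 0], vector [1, 0], vector [0, 1]}) T"

text \<open>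
  Dilations are taken up to lattice translation: the centre of the dilation is an arbitrary lattice
  point, which need not be the origin.
\<close>

definition second_dilation_of :: "(real^2) set \<Rightarrow> (real^2) set \<Rightarrow> bool" where
  "second_dilation_of P T \<longleftrightarrow> (\<exists>t \<in> int_lattice. P = (\<lambda>x. t + 2 *\<^sub>R x) ` T)"

definition reflexive_polygon :: "(real^2) set \<Rightarrow> bool" where
  "reflexive_polygon P \<longleftrightarrow> lattice_polygon P \<and> card (lattice_points (interior P)) = 1"

end

theory Submission
  imports Defs
begin

text \<open>
  An essential vertex \<open>v\<close> of \<open>A'\<close> is separated from the other points of \<open>A'\<close> by an integer functional
  that is at least \<open>2\<close> on \<open>v\<close> and takes only the values \<open>0\<close> and \<open>1\<close> elsewhere. A \<open>3\<close>-polytope has four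
  vertices, so \<open>A'\<close> has at least three essential vertices \<open>v1\<close>, \<open>v2\<close>, \<open>v3\<close>, with functionals \<open>f1\<close>, \<open>f2\<close>,
  \<open>f3\<close>. If the functionals are pairwise non-parallel, two of them embed the remaining points and one
  vertex into \<open>{0, 1}\<^sup>2\<close>, whence \<open>card A' \<le> 6\<close>, and equality forces a triangle with its edge midpoints.
  If two of them are parallel, they add up to \<open>2\<close>, and \<open>A'\<close> lies on three parallel lines, all points
  but \<open>v1\<close> and \<open>v2\<close> on the middle one.

  The three-dimensional hypotheses enter through one lifting argument: a fibre of the projection with
  several lattice points, together with a lattice point further away, forces fibres with long
  lattice segments in between, hence further points of \<open>A'\<close>. As the fibres of the vertices are single
  points and \<open>P\<close> has at least seven lattice points, the few remaining points of \<open>A'\<close> have large fibres,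
  and this excludes all other configurations.
\<close>

subsection \<open>Integer functionals and width\<close>

text \<open>Only three essential vertices are fixed; any further vertex of the hull, essential or
  not, counts among the remaining points. The set \<open>A'\<close> may miss lattice points of
  \<open>P'\<close>, so a gap in \<open>A'\<close> is contradictory only where lifting fills it. The
  bound 7 enters as 4 = 7 - 3, the number of lattice points over the remaining points. With two
  remaining points this is exactly what lifting needs: either one given point of the two has a fibre
  of size two, or the other has one of size three. A fibre with several points also shows that its
  base point is not a vertex; hence with one or two remaining points one of them lies in the hull of
  the others, and convex position never has to be treated. Non-parallel functionals matter because
  two of them are injective coordinates on the whole plane; if two are parallel, the third is
  parallel to neither and takes over as the second coordinate.\<close>

lemma affine_map_combination:
  assumes "affine_map f" "a + b + c = 1"
  shows "f (a *\<^sub>R x + b *\<^sub>R y + c *\<^sub>R z) = a *\<^sub>R f x + b *\<^sub>R f y + c *\<^sub>R f z"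
proof -
  define g where "g = (\<lambda>x. f x - f 0)"
  have "linear g"
    using assms(1) by (simp add: affine_map_def g_def)
  then have "g (a *\<^sub>R x + b *\<^sub>R y + c *\<^sub>R z) = a *\<^sub>R g x + b *\<^sub>R g y + c *\<^sub>R g z"
    by (simp add: linear_add linear_scale)
  then have "f (a *\<^sub>R x + b *\<^sub>R y + c *\<^sub>R z)
      = a *\<^sub>R (f x - f 0) + b *\<^sub>R (f y - f 0) + c *\<^sub>R (f z - f 0) + f 0"
    by (simp add: g_def diff_eq_eq)
  also have "\<dots> = a *\<^sub>R f x + b *\<^sub>R f y + c *\<^sub>R f z - (a + b + c) *\<^sub>R f 0 + f 0"
    by (simp add: algebra_simps)
  finally show ?thesis
    using assms(2) by simp
qed

lemma affine_map_combination2: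
  assumes "affine_map f" "a + b = 1"
  shows "f (a *\<^sub>R x + b *\<^sub>R y) = a *\<^sub>R f x + b *\<^sub>R f y"
  using affine_map_combination[of f a b 0 x y 0] assms by simp

lemma affine_map_convex_hull:
  assumes "affine_map f" "x \<in> convex hull S"
  shows "f x \<in> convex hull (f ` S)"
proof -
  have "convex {x. f x \<in> convex hull (f ` S)}"
    by (auto intro!: convexI convexD[OF convex_convex_hull]
        simp: affine_map_combination2[OF assms(1)])
  moreover have "S \<subseteq> {x. f x \<in> convex hull (f ` S)}"
    by (auto intro: hull_inc)
  ultimately show ?thesis
    using assms(2) hull_minimal[of S "{x. f x \<in> convex hull (f ` S)}" convex] by blast
qed

lemma affine_map_le_hull:
  fixes f :: "'a::real_vector \<Rightarrow> real"
  assumes "affine_map f" "x \<in> convex hull S" "\<And>y. y \<in> S \<Longrightarrow> f y \<le> b"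
  shows "f x \<le> b"
proof -
  have "convex hull (f ` S) \<subseteq> {..b}"
    by (rule hull_minimal) (use assms(3) in auto)
  then show ?thesis
    using affine_map_convex_hull[OF assms(1,2)] by auto
qed

lemma affine_map_ge_hull:
  fixes f :: "'a::real_vector \<Rightarrow> real"
  assumes "affine_map f" "x \<in> convex hull S" "\<And>y. y \<in> S \<Longrightarrow> b \<le> f y"
  shows "b \<le> f x"
proof -
  have "convex hull (f ` S) \<subseteq> {b..}"
    by (rule hull_minimal) (use assms(3) in auto)
  then show ?thesis
    using affine_map_convex_hull[OF assms(1,2)] by auto
qed

lemma integer_functional_affine: "integer_functional f \<Longrightarrow> affine_map f"
  by (simp add: integer_functional_def)

lemma integer_functional_Ints:
  "integer_functional f \<Longrightarrow> x \<in> int_lattice \<Longrightarrow> f x \<in> \<int>"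
  by (auto simp: integer_functional_def)

section \<open>Extent of an affine functional over a convex hull\<close>

lemma bounded_extent:
  fixes f :: "real^'n \<Rightarrow> real"
  assumes "affine_map f" "finite S" "S \<noteq> {}"
  shows "bdd_above (f ` (convex hull S))" "bdd_below (f ` (convex hull S))"
proof -
  have "f x \<le> Max (f ` S)" "Min (f ` S) \<le> f x" if "x \<in> convex hull S" for x
    using affine_map_le_hull[OF assms(1) that] affine_map_ge_hull[OF assms(1) that] assms(2)
    by auto
  then show "bdd_above (f ` (convex hull S))" "bdd_below (f ` (convex hull S))"
    by (auto simp: bdd_above_def bdd_below_def)
qed

lemma extent_ge:
  fixes f :: "real^'n \<Rightarrow> real"
  assumes "affine_map f" "finite S" "x \<in> S" "y \<in> S"
  shows "f y - f x \<le> Sup (f ` (convex hull S)) - Inf (f ` (convex hull S))"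
proof -
  have ne: "S \<noteq> {}"
    using assms(3) by auto
  have "f y \<le> Sup (f ` (convex hull S))"
    using bounded_extent(1)[OF assms(1,2) ne] assms(3,4)
    by (intro cSup_upper imageI hull_inc) auto
  moreover have "Inf (f ` (convex hull S)) \<le> f x"
    using bounded_extent(2)[OF assms(1,2) ne] assms(3,4)
    by (intro cInf_lower imageI hull_inc) auto
  ultimately show ?thesis by simp
qed

lemma extent_le:
  fixes f :: "real^'n \<Rightarrow> real"
  assumes "affine_map f" "finite S" "S \<noteq> {}" "\<And>x y. x \<in> S \<Longrightarrow> y \<in> S \<Longrightarrow> f y - f x \<le> b"
  shows "Sup (f ` (convex hull S)) - Inf (f ` (convex hull S)) \<le> b"
proof -
  obtain x where x: "x \<in> S" "\<And>y. y \<in> S \<Longrightarrow> f x \<le> f y"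
    using assms(2,3) using ex_min_if_finite[of "f ` S"] by (auto simp: not_less)
  have "f z \<le> f x + b" "f x \<le> f z" if "z \<in> convex hull S" for z
    using affine_map_le_hull[OF assms(1) that] affine_map_ge_hull[OF assms(1) that] x assms(4)
    by (auto simp: algebra_simps)
  then have "Sup (f ` (convex hull S)) \<le> f x + b" "f x \<le> Inf (f ` (convex hull S))"
    using assms(3) by (auto intro!: cSup_least cInf_greatest)
  then show ?thesis by simp
qed

text \<open>An affine functional takes its extremes over a hull at the spanning points, so width
  greater than one becomes a statement on pairs of points of \<open>S\<close>, free of suprema and
  infima, that passes easily to projections.\<close>

definition wide :: "(real^'n) set \<Rightarrow> bool" where
  "wide S \<longleftrightarrow> (\<forall>f. integer_functional f \<and> \<not> f constant_on UNIV \<longrightarrow>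
     (\<exists>x\<in>S. \<exists>y\<in>S. f y - f x > 1))"

lemma wide_if_width_gt_1:
  fixes S :: "(real^'n) set"
  assumes "finite S" "width (convex hull S) > 1"
  shows "wide S"
  unfolding wide_def
proof (intro allI impI, rule ccontr)
  fix f :: "real^'n \<Rightarrow> real"
  let ?E = "{Sup (f ` (convex hull S)) - Inf (f ` (convex hull S)) | f.
    integer_functional f \<and> \<not> f constant_on UNIV}"
  assume f: "integer_functional f \<and> \<not> f constant_on UNIV"
    and n: "\<not> (\<exists>x\<in>S. \<exists>y\<in>S. f y - f x > 1)"
  \<comment> \<open>The width is 0 by convention off full dimension, so a positive width already
    forces it.\<close>
  have dim: "aff_dim (convex hull S) = int CARD('n)"
    using assms(2) by (auto simp: width_def split: if_splits)
  then have ne: "S \<noteq> {}"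
    by auto
  then obtain x where "x \<in> S" by auto
  have "0 \<le> e" if "e \<in> ?E" for e
    using that extent_ge[OF integer_functional_affine assms(1) \<open>x \<in> S\<close> \<open>x \<in> S\<close>] by force
  then have "bdd_below ?E"
    by (rule bdd_belowI)
  then have "Inf ?E \<le> Sup (f ` (convex hull S)) - Inf (f ` (convex hull S))"
    using f by (intro cInf_lower) auto
  also have "\<dots> \<le> 1"
    using n by (intro extent_le integer_functional_affine assms(1) ne) (use f n in \<open>auto simp: not_less\<close>)
  finally show False
    using assms(2) dim by (simp add: width_def)
qed

lemma integer_functional_coordinate:
  "integer_functional (\<lambda>x::real^'n. x $ i)" "\<not> (\<lambda>x::real^'n. x $ i) constant_on UNIV"
proof -
  show "integer_functional (\<lambda>x::real^'n. x $ i)"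
    by (auto simp: integer_functional_def affine_map_def int_lattice_def linear_iff)
  show "\<not> (\<lambda>x::real^'n. x $ i) constant_on UNIV"
  proof
    assume "(\<lambda>x::real^'n. x $ i) constant_on UNIV"
    then obtain c where "\<And>x::real^'n. x $ i = c"
      by (auto simp: constant_on_def)
    from this[of 0] this[of 1] show False
      by simp
  qed
qed

text \<open>Integrality opens a gap: an extent above 1 on lattice points is at least 2. An infimum
  of at most 1 therefore yields a functional of extent at most 1, without an argument that the
  infimum is attained.\<close>

lemma functional_if_width_le_1:
  fixes S :: "(real^'n) set"
  assumes "finite S" "S \<subseteq> int_lattice" "aff_dim S = int CARD('n)" "width (convex hull S) \<le> 1"
  shows "\<exists>f. integer_functional f \<and> \<not> f constant_on UNIV \<and> (\<forall>x\<in>S. \<forall>y\<in>S. f y - f x \<le> 1)"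
proof (rule ccontr)
  assume n: "\<not> ?thesis"
  let ?E = "{Sup (f ` (convex hull S)) - Inf (f ` (convex hull S)) | f.
    integer_functional f \<and> \<not> f constant_on UNIV}"
  have "2 \<le> e" if e: "e \<in> ?E" for e
  proof -
    obtain f where f: "integer_functional f" "\<not> f constant_on UNIV"
      and e: "e = Sup (f ` (convex hull S)) - Inf (f ` (convex hull S))"
      using e by blast
    then obtain x y where xy: "x \<in> S" "y \<in> S" "f y - f x > 1"
      using n by (meson linorder_not_le)
    have "f y - f x \<in> \<int>"
      using xy assms(2) f(1) by (meson Ints_diff integer_functional_Ints subsetD)
    then have "f y - f x \<ge> 2"
      using xy(3) by (auto elim!: Ints_cases)
    then show ?thesis
      using extent_ge[OF integer_functional_affine[OF f(1)] assms(1) xy(1,2)] e by linarith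
  qed
  moreover have "?E \<noteq> {}"
    using integer_functional_coordinate by fastforce
  ultimately have "Inf ?E \<ge> 2"
    by (intro cInf_greatest)
  then show False
    using assms(3,4) by (simp add: width_def aff_dim_convex_hull)
qed

subsection \<open>Integer functionals on the plane\<close>

lemma int_lattice_2: "(x::real^2) \<in> int_lattice \<longleftrightarrow> x $ 1 \<in> \<int> \<and> x $ 2 \<in> \<int>"
  by (auto simp: int_lattice_def forall_2)

lemma int_lattice_add: "x \<in> int_lattice \<Longrightarrow> y \<in> int_lattice \<Longrightarrow> x + y \<in> int_lattice"
  and int_lattice_diff: "x \<in> int_lattice \<Longrightarrow> y \<in> int_lattice \<Longrightarrow> x - y \<in> int_lattice"
  and int_lattice_scaleR: "a \<in> \<int> \<Longrightarrow> x \<in> int_lattice \<Longrightarrow> a *\<^sub>R x \<in> int_lattice"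
  by (auto simp: int_lattice_def)

lemma affine_map_2E:
  fixes f :: "real^2 \<Rightarrow> real"
  assumes "affine_map f"
  obtains s t c where "f = (\<lambda>x. s * x $ 1 + t * x $ 2 + c)"
    "s = f (vector [1, 0]) - f 0" "t = f (vector [0, 1]) - f 0" "c = f 0"
proof -
  define g where "g = (\<lambda>x. f x - f 0)"
  have g: "linear g"
    using assms by (simp add: affine_map_def g_def)
  have "f x = (f (vector [1, 0]) - f 0) * x $ 1 + (f (vector [0, 1]) - f 0) * x $ 2 + f 0" for x
  proof -
    have "x = (x $ 1) *\<^sub>R vector [1, 0] + (x $ 2) *\<^sub>R vector [0, 1]"
      by (simp add: vec_eq_iff forall_2)
    then have "g x = g ((x $ 1) *\<^sub>R vector [1, 0] + (x $ 2) *\<^sub>R vector [0, 1])"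
      by simp
    also have "\<dots> = x $ 1 * g (vector [1, 0]) + x $ 2 * g (vector [0, 1])"
      using g by (simp add: linear_add linear_scale)
    finally
show ?thesis
      by (simp add: g_def algebra_simps)
  qed
  then show ?thesis
    using that[OF ext refl refl refl] by blast
qed

lemma integer_functional_2E:
  fixes f :: "real^2 \<Rightarrow> real"
  assumes "integer_functional f"
  obtains s t c where "f = (\<lambda>x. s * x $ 1 + t * x $ 2 + c)" "s \<in> \<int>" "t \<in> \<int>" "c \<in> \<int>"
proof -
  have "(0::real^2) \<in> int_lattice" "(vector [1, 0] :: real^2) \<in> int_lattice"
    "(vector [0, 1] :: real^2) \<in> int_lattice"
    by (auto simp: int_lattice_2)
  then have "f 0 \<in> \<int>" "f (vector [1, 0]) - f 0 \<in> \<int>" "f (vector [0, 1]) - f 0 \<in> \<int>"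
    using assms by (auto intro!: integer_functional_Ints Ints_diff)
  then show ?thesis
    using affine_map_2E[OF integer_functional_affine[OF assms]] that by blast
qed

lemma affine_map_2I:
  fixes f :: "real^2 \<Rightarrow> real"
  assumes "\<And>x. f x = s * x $ 1 + t * x $ 2 + c"
  shows "affine_map f"
  unfolding affine_map_def by (auto simp: assms linear_iff algebra_simps)

lemma integer_functional_2I:
  fixes f :: "real^2 \<Rightarrow> real"
  assumes "\<And>x. f x = s * x $ 1 + t * x $ 2 + c" "s \<in> \<int>" "t \<in> \<int>" "c \<in> \<int>"
  shows "integer_functional f"
  unfolding integer_functional_def
proof
  show "affine_map f"
    by (rule affine_map_2I[OF assms(1)])
  show "f ` int_lattice \<subseteq> \<int>"
    using assms(2-4) by (auto simp: assms(1) int_lattice_2)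
qed

lemma integer_functional_diff_const:
  fixes f :: "real^2 \<Rightarrow> real"
  assumes "integer_functional f" "b \<in> \<int>"
  shows "integer_functional (\<lambda>x. f x - b)" "integer_functional (\<lambda>x. b - f x)"
proof -
  obtain s t c where f: "f = (\<lambda>x. s * x $ 1 + t * x $ 2 + c)" "s \<in> \<int>" "t \<in> \<int>" "c \<in> \<int>"
    using integer_functional_2E[OF assms(1)] by blast
  show "integer_functional (\<lambda>x. f x - b)"
    by (rule integer_functional_2I[of _ s t "c - b"]) (use f assms(2) in auto)
  show "integer_functional (\<lambda>x. b - f x)"
    by (rule integer_functional_2I[of _ "-s" "-t" "b - c"]) (use f assms(2) in auto)
qed

lemma integer_functional_diff:
  fixes f g :: "real^2 \<Rightarrow> real"
  assumes "integer_functional f" "integer_functional g"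
  shows "integer_functional (\<lambda>x. f x - g x)"
proof -
  obtain s t c where f: "f = (\<lambda>x. s * x $ 1 + t * x $ 2 + c)" "s \<in> \<int>" "t \<in> \<int>" "c \<in> \<int>"
    using integer_functional_2E[OF assms(1)] by blast
  obtain s' t' c' where g: "g = (\<lambda>x. s' * x $ 1 + t' * x $ 2 + c')" "s' \<in> \<int>" "t' \<in> \<int>" "c' \<in> \<int>"
    using integer_functional_2E[OF assms(2)] by blast
  show ?thesis
    by (rule integer_functional_2I[of _ "s - s'" "t - t'" "c - c'"])
      (use f g in \<open>auto simp: algebra_simps\<close>)
qed

text \<open>The determinant. For lattice points \<open>u\<close> and \<open>p\<close>, the function
  \<open>cross2 u (x - p)\<close> of \<open>x\<close> is an integer functional that vanishes on the
  line through \<open>p\<close> in direction \<open>u\<close>; functionals are built from edges in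
  this way.\<close>

definition cross2 :: "real^2 \<Rightarrow> real^2 \<Rightarrow> real" where
  "cross2 u w = u $ 1 * w $ 2 - u $ 2 * w $ 1"

lemma cross2_parallel [simp]: "cross2 (a *\<^sub>R u) (b *\<^sub>R u) = 0"
  by (simp add: cross2_def)

lemma integer_functional_cross2:
  assumes "u \<in> int_lattice" "p \<in> int_lattice"
  shows "integer_functional (\<lambda>x. cross2 u (x - p))"
  by (rule integer_functional_2I[of _ "- u $ 2" "u $ 1" "u $ 2 * p $ 1 - u $ 1 * p $ 2"])
    (use assms in \<open>auto simp: cross2_def int_lattice_2 algebra_simps\<close>)

text \<open>In the plane both gradients are orthogonal to \<open>y - x\<close>, hence parallel. The
  gradient of the nonconstant \<open>f\<close> is not zero, and \<open>k\<close> is the coefficient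
  of the orthogonal projection of the other gradient onto it.\<close>

lemma affine_proportional:
  fixes f g :: "real^2 \<Rightarrow> real"
  assumes "affine_map f" "affine_map g" "x \<noteq> y" "f x = f y" "g x = g y" "f a \<noteq> f b"
  obtains k where "\<forall>z. g z - g x = k * (f z - f x)"
proof -
  obtain s t c where f: "f = (\<lambda>x. s * x $ 1 + t * x $ 2 + c)"
    using affine_map_2E[OF assms(1)] by blast
  obtain s' t' c' where g: "g = (\<lambda>x. s' * x $ 1 + t' * x $ 2 + c')"
    using affine_map_2E[OF assms(2)] by blast
  define d where "d = y - x"
  have "s \<noteq> 0 \<or> t \<noteq> 0"
    using assms(6) by (auto simp: f)
  then have n: "s * s + t * t \<noteq> 0"
    by (simp add: sum_squares_eq_zero_iff)
  have d: "d $ 1 \<noteq> 0 \<or> d $ 2 \<noteq> 0"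
    using assms(3) by (auto simp: d_def vec_eq_iff forall_2)
  have e: "s * d $ 1 + t * d $ 2 = 0" "s' * d $ 1 + t' * d $ 2 = 0"
    using assms(4,5) by (auto simp: f g d_def algebra_simps)
  have "(s * t' - s' * t) * d $ 1 = t' * (s * d $ 1 + t * d $ 2) - t * (s' * d $ 1 + t' * d $ 2)"
    "(s * t' - s' * t) * d $ 2 = s * (s' * d $ 1 + t' * d $ 2) - s' * (s * d $ 1 + t * d $ 2)"
    by algebra+
  then have p: "s * t' = s' * t"
    using d e by auto
  define k where "k = (s * s' + t * t') / (s * s + t * t)"
  have "k * s = s' * (s * s + t * t) / (s * s + t * t)"
    using p by (simp add: k_def algebra_simps)
  then have ks: "k * s = s'"
    using n by force
  have "k * t = t' * (s * s + t * t) / (s * s + t * t)"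
    using p by (simp add: k_def algebra_simps)
  then have kt: "k * t = t'"
    using n by force
  have "g z - g x = k * (f z - f x)" for z
    by (simp add: f g flip: ks kt) (simp add: algebra_simps)
  then show ?thesis
    using that by blast
qed

text \<open>The orientation \<open>f v \<ge> 2\<close> can be reached by passing to \<open>1 - f\<close>.\<close>

definition separates :: "(real^2 \<Rightarrow> real) \<Rightarrow> real^2 \<Rightarrow> (real^2) set \<Rightarrow> bool" where
  "separates f v S \<longleftrightarrow> integer_functional f \<and> f v \<ge> 2 \<and> (\<forall>x\<in>S - {v}. f x = 0 \<or> f x = 1)"

lemma narrow_constant:
  fixes f :: "real^2 \<Rightarrow> real"
  assumes "wide S" "integer_functional f" "\<And>x y. x \<in> S \<Longrightarrow> y \<in> S \<Longrightarrow> f y - f x \<le> 1"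
  shows "f x = f y"
proof (rule ccontr)
  assume "f x \<noteq> f y"
  then have "\<not> f constant_on UNIV"
    by (metis UNIV_I constant_on_def)
  then show False
    using assms unfolding wide_def by (meson not_le)
qed

text \<open>Deleting a vertex may leave points on a line. Their width is then 0 by convention, which
  provides no functional, so one is built from the line itself.\<close>

lemma collinear_functional:
  fixes T :: "(real^2) set"
  assumes "collinear T" "T \<subseteq> int_lattice"
  shows "\<exists>f. integer_functional f \<and> \<not> f constant_on UNIV \<and> (\<forall>x\<in>T. \<forall>y\<in>T. f x = f y)"
proof (cases "\<exists>x\<in>T. \<exists>y\<in>T. x \<noteq> y")
  case True
  then obtain x y where xy: "x \<in> T" "y \<in> T" "x \<noteq> y"
    by blast
  obtain u where u: "\<And>a b. a \<in> T \<Longrightarrow> b \<in> T \<Longrightarrow> \<exists>c. a - b = c *\<^sub>R u"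
    using assms(1) by (auto simp: collinear_def)
  let ?f = "\<lambda>z. cross2 (y - x) (z - x)"
  have "?f z = 0" if "z \<in> T" for z
    using u[OF xy(2,1)] u[OF that xy(1)] by auto
  moreover have "integer_functional ?f"
    using xy assms(2) by (intro integer_functional_cross2) (auto intro: int_lattice_diff)
  moreover have "\<not> ?f constant_on UNIV"
  proof
    assume "?f constant_on UNIV"
    then obtain c where c: "\<And>z. ?f z = c"
      by (auto simp: constant_on_def)
    have "c = 0"
      using c[of x] by (simp add: cross2_def)
    then have "(y - x) $ 2 = 0" "(y - x) $ 1 = 0"
      using c[of "x + vector [1, 0]"] c[of "x + vector [0, 1]"] by (simp_all add: cross2_def)
    then show False
      using xy(3) by (simp add: vec_eq_iff forall_2)
  qed
  ultimately show ?thesis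
    by (intro exI[of _ ?f]) simp
next
  case False
  then show ?thesis
    by (intro exI[of _ "\<lambda>x::real^2. x $ 1"] conjI integer_functional_coordinate) auto
qed

text \<open>Shifting the minimum over the other points to 0 leaves them the values 0 and 1. Were the
  value at \<open>v\<close> also between 0 and 1, \<open>g\<close> would contradict that
  \<open>S\<close> is wide. A negative value is turned around by \<open>1 - g\<close>, which
  exchanges 0 and 1.\<close>

lemma essential_vertex_separates:
  fixes S :: "(real^2) set"
  assumes "finite S" "S \<subseteq> int_lattice" "wide S" "v \<in> essential_vertices S"
    and "S - {v} \<noteq> {}"
  obtains f where "separates f v S"
proof -
  let ?T = "S - {v}"
  have w: "width (convex hull ?T) \<le> 1" and v: "v \<in> S"
    using assms(4) extreme_point_of_convex_hull[of v S]
    by (auto simp: essential_vertices_def vertices_def)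
  have "\<exists>f. integer_functional f \<and> \<not> f constant_on UNIV \<and> (\<forall>x\<in>?T. \<forall>y\<in>?T. f y - f x \<le> 1)"
  proof (cases "aff_dim ?T = 2")
    case True
    then have "aff_dim ?T = int CARD(2)" "finite ?T" "?T \<subseteq> int_lattice"
      using assms(1,2) by auto
    then show ?thesis
      using functional_if_width_le_1[OF _ _ _ w] by simp
  next
    case False
    then have "aff_dim ?T \<le> 1"
      using aff_dim_le_DIM[of ?T] by simp
    then have "collinear ?T" "?T \<subseteq> int_lattice"
      using assms(2) by (auto simp: collinear_aff_dim)
    from collinear_functional[OF this] obtain f where
      f: "integer_functional f \<and> \<not> f constant_on UNIV \<and> (\<forall>x\<in>?T. \<forall>y\<in>?T. f x = f y)" ..
    have "f y - f x \<le> 1" if "x \<in> ?T" "y \<in> ?T" for x y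
    proof -
      have "f x = f y"
        using f that by blast
      then show ?thesis by simp
    qed
    then show ?thesis
      by (intro exI[of _ f] conjI ballI conjunct1[OF f] conjunct1[OF conjunct2[OF f]])
  qed
  then obtain f where "integer_functional f \<and> \<not> f constant_on UNIV \<and>
    (\<forall>x\<in>?T. \<forall>y\<in>?T. f y - f x \<le> 1)" ..
  then have f: "integer_functional f" "\<not> f constant_on UNIV"
    "\<And>x y. x \<in> ?T \<Longrightarrow> y \<in> ?T \<Longrightarrow> f y - f x \<le> 1"
    by simp_all
  obtain x where x: "x \<in> ?T" "\<And>y. y \<in> ?T \<Longrightarrow> f x \<le> f y"
    using ex_min_if_finite[of "f ` ?T"] assms(1,5) by (auto simp: not_less)
  have int: "f y \<in> \<int>" if "y \<in> S" for y
    using that assms(2) f(1) integer_functional_Ints by blast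
  define g where "g y = f y - f x" for y
  have g: "integer_functional g"
    using integer_functional_diff_const(1)[OF f(1) int] x(1) by (simp add: g_def[abs_def])
  have g_int: "g y \<in> \<int>" if "y \<in> S" for y
    using that assms(2) g integer_functional_Ints by blast
  have gT: "g y = 0 \<or> g y = 1" if "y \<in> ?T" for y
  proof -
    have "0 \<le> g y" "g y \<le> 1" "g y \<in> \<int>"
      using x f(3)[OF x(1) that] g_int that by (auto simp: g_def)
    then show ?thesis
      by (auto elim!: Ints_cases)
  qed
  obtain a b where ab: "f a \<noteq> f b"
    using f(2) unfolding constant_on_def by metis
  have ngv: "\<not> (0 \<le> g v \<and> g v \<le> 1)"
  proof
    assume "0 \<le> g v \<and> g v \<le> 1"
    then have "0 \<le> g y \<and> g y \<le> 1" if "y \<in> S" for y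
      using gT[of y] that by (cases "y = v") auto
    then have "g a = g b"
      by (intro narrow_constant[OF assms(3) g]) (smt (verit))
    then show False
      using ab by (simp add: g_def)
  qed
  show ?thesis
  proof (cases "g v > 1")
    case True
    then have "g v \<ge> 2"
      using g_int[OF v] by (auto elim!: Ints_cases)
    then show ?thesis
      using that[of g] g gT by (auto simp: separates_def)
  next
    case False
    then have "g v < 0"
      using ngv by auto
    then have "1 - g v \<ge> 2"
      using g_int[OF v] by (auto elim!: Ints_cases)
    then show ?thesis
      using that[of "\<lambda>x. 1 - g x"] integer_functional_diff_const(2)[OF g, of 1] gT
      by (force simp: separates_def)
  qed
qed

subsection \<open>Lifting lattice points along the projection\<close>

text \<open>Cross products complete a dual pair to dual bases and keep integrality. The inner
  product of the two cross products is the determinant of the matrix of all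
  \<open>ri \<bullet> bj\<close>, here 1, so \<open>M\<close> (with these rows) and \<open>N\<close>
  (with these columns) are inverse to each other; the claim is
  \<open>N ** M = mat 1\<close>.\<close>

lemma dual_basis_cross3:
  fixes r1 r2 b1 b2 x :: "real^3"
  assumes "r1 \<bullet> b1 = 1" "r1 \<bullet> b2 = 0" "r2 \<bullet> b1 = 0" "r2 \<bullet> b2 = 1"
  shows "x = (r1 \<bullet> x) *\<^sub>R b1 + (r2 \<bullet> x) *\<^sub>R b2 + (cross3 b1 b2 \<bullet> x) *\<^sub>R cross3 r1 r2"
proof -
  define M where "M = (vector [r1, r2, cross3 b1 b2] :: real^3^3)"
  define N where "N = transpose (vector [b1, b2, cross3 r1 r2] :: real^3^3)"
  have "cross3 b1 b2 \<bullet> cross3 r1 r2 = 1"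
    using assms by (simp add: dot_cross inner_commute)
  then have "M ** N = mat 1"
    using assms
    by (simp add: vec_eq_iff forall_3 matrix_matrix_mult_def M_def N_def transpose_def mat_def
        dot_cross_self flip: inner_vec_def[where 'a=real, unfolded inner_real_def])
  then have "N ** M = mat 1"
    by (simp add: matrix_left_right_inverse)
  then have "x = N *v (M *v x)"
    by (simp add: matrix_vector_mul_assoc)
  also have "M *v x = vector [r1 \<bullet> x, r2 \<bullet> x, cross3 b1 b2 \<bullet> x]"
    by (simp add: vec_eq_iff forall_3 M_def matrix_vector_mult_def inner_vec_def)
  also have "N *v \<dots> = (r1 \<bullet> x) *\<^sub>R b1 + (r2 \<bullet> x) *\<^sub>R b2 + (cross3 b1 b2 \<bullet> x) *\<^sub>R cross3 r1 r2"
    by (simp add: vec_eq_iff forall_3 N_def matrix_vector_mult_def transpose_def sum_3 mult.commute)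
  finally show ?thesis .
qed

lemma int_lattice_cross3:
  "x \<in> int_lattice \<Longrightarrow> y \<in> int_lattice \<Longrightarrow> cross3 x y \<in> int_lattice"
  by (auto simp: int_lattice_def cross3_def forall_3)

lemma int_lattice_inner:
  "x \<in> int_lattice \<Longrightarrow> y \<in> int_lattice \<Longrightarrow> x \<bullet> y \<in> \<int>"
  by (auto simp: int_lattice_def inner_vec_def intro!: Ints_sum)

text \<open>The height function \<open>h\<close> complements the projection to a system of lattice coordinates on space.\<close>

lemma projection_height:
  fixes \<pi> :: "real^3 \<Rightarrow> real^2"
  assumes "lattice_projection \<pi>"
  obtains h :: "real^3 \<Rightarrow> real" where "linear h" "h ` int_lattice \<subseteq> \<int>"
    "\<And>x. \<pi> x \<in> int_lattice \<Longrightarrow> h x \<in> \<int> \<Longrightarrow> x \<in> int_lattice"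
    "\<And>x y. \<pi> x = \<pi> y \<Longrightarrow> h x = h y \<Longrightarrow> x = y"
proof -
  define L where "L = (\<lambda>x. \<pi> x - \<pi> 0)"
  have lin: "linear L" and im: "\<pi> ` int_lattice = int_lattice"
    using assms by (auto simp: lattice_projection_def affine_map_def L_def)
  have 0: "(0::real^3) \<in> int_lattice"
    by (simp add: int_lattice_def)
  then have \<pi>0: "\<pi> 0 \<in> int_lattice"
    using im by blast
  have L_lat: "L x \<in> int_lattice" if "x \<in> int_lattice" for x
    using that im \<pi>0 by (auto simp: L_def intro: int_lattice_diff)
  have L_surj: "\<exists>x\<in>int_lattice. L x = y" if "y \<in> int_lattice" for y
  proof -
    have "y + \<pi> 0 \<in> \<pi> ` int_lattice"
      using im int_lattice_add[OF that \<pi>0] by simp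
    then obtain x where "x \<in> int_lattice" "y + \<pi> 0 = \<pi> x"
      by blast
    then show ?thesis
      by (intro bexI[of _ x]) (simp_all add: L_def algebra_simps)
  qed
  define r where "r i = (\<chi> j. L (axis j 1) $ i)" for i
  have r_inner: "L x $ i = r i \<bullet> x" for x i
  proof -
    have "L x = (\<Sum>j\<in>UNIV. x $ j *\<^sub>R L (axis j 1))"
      using linear_sum[OF lin, of "\<lambda>j. x $ j *\<^sub>R axis j 1" UNIV] linear_scale[OF lin]
      by (simp add: basis_expansion[of x, unfolded scalar_mult_eq_scaleR])
    then show ?thesis
      by (simp add: r_def inner_vec_def mult.commute)
  qed
  have r_lat: "r i \<in> int_lattice" for i
  proof -
    have "L (axis j 1) \<in> int_lattice" for j
      by (rule L_lat) (simp add: int_lattice_def axis_def)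
    then show ?thesis
      by (simp add: r_def int_lattice_def)
  qed
  obtain b1 where b1: "b1 \<in> int_lattice" "L b1 = vector [1, 0]"
    using L_surj[of "vector [1, 0]"] by (auto simp: int_lattice_2)
  obtain b2 where b2: "b2 \<in> int_lattice" "L b2 = vector [0, 1]"
    using L_surj[of "vector [0, 1]"] by (auto simp: int_lattice_2)
  \<comment> \<open>The coordinate along \<open>cross3 (r 1) (r 2)\<close>, which spans the kernel
    of \<open>L\<close>. Both cross products are integral, so \<open>L x\<close> and
    \<open>h x\<close> are lattice coordinates.\<close>
  define h where "h x = cross3 b1 b2 \<bullet> x" for x
  have x: "x = (L x $ 1) *\<^sub>R b1 + (L x $ 2) *\<^sub>R b2 + h x *\<^sub>R cross3 (r 1) (r 2)" for x
    unfolding r_inner h_def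
    by (rule dual_basis_cross3) (use b1 b2 in \<open>simp_all flip: r_inner\<close>)
  show ?thesis
  proof (rule that[of h])
    show "linear h"
      by (simp add: h_def linear_iff inner_right_distrib)
    show "h ` int_lattice \<subseteq> \<int>"
      using b1 b2 by (auto simp: h_def intro!: int_lattice_inner int_lattice_cross3)
    show "x \<in> int_lattice" if "\<pi> x \<in> int_lattice" "h x \<in> \<int>" for x
    proof -
      have "L x \<in> int_lattice"
        using that \<pi>0 by (auto simp: L_def intro: int_lattice_diff)
      then have "(L x $ 1) *\<^sub>R b1 + (L x $ 2) *\<^sub>R b2 + h x *\<^sub>R cross3 (r 1) (r 2) \<in> int_lattice"
        using that b1 b2 r_lat
        by (intro int_lattice_add int_lattice_scaleR int_lattice_cross3) (auto simp: int_lattice_2)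
      then show ?thesis
        using x[of x] by simp
    qed
    show "x = y" if "\<pi> x = \<pi> y" "h x = h y" for x y
      using x[of x] x[of y] that by (simp add: L_def)
  qed
qed

lemma card_Ints_le:
  assumes "finite X" "X \<noteq> {}" "X \<subseteq> \<int>"
  shows "real (card X) \<le> Max X - Min X + (1::real)"
proof -
  have "of_int ` {\<lceil>Min X\<rceil>..\<lfloor>Max X\<rfloor>} \<supseteq> X"
  proof
    fix x assume "x \<in> X"
    then obtain z where "x = of_int z"
      using assms(3) by (auto elim!: Ints_cases)
    moreover have "Min X \<le> x" "x \<le> Max X"
      using assms(1) \<open>x \<in> X\<close> by auto
    ultimately show "x \<in> of_int ` {\<lceil>Min X\<rceil>..\<lfloor>Max X\<rfloor>}"
      by (auto simp: ceiling_le_iff le_floor_iff)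
  qed
  then have "card X \<le> card {\<lceil>Min X\<rceil>..\<lfloor>Max X\<rfloor>}"
    by (meson card_image_le card_mono finite_atLeastAtMost_int finite_imageI le_trans)
  moreover have "Min X \<in> X" "Max X \<in> X"
    using assms by auto
  then have "Min X = of_int \<lceil>Min X\<rceil>" "Max X = of_int \<lfloor>Max X\<rfloor>" "Min X \<le> Max X"
    using assms by (auto elim!: Ints_cases simp: subset_iff)
  then have "real (card {\<lceil>Min X\<rceil>..\<lfloor>Max X\<rfloor>}) = Max X - Min X + 1"
    by (simp add: of_nat_nat)
  ultimately show ?thesis
    by linarith
qed

text \<open>At level \<open>j\<close> of the segment from \<open>p\<close> to \<open>p + m *\<^sub>R w\<close>, the fibre of \<open>P\<close> contains a segment of
  length \<open>k * (m - j) / m\<close> whose endpoints have heights in \<open>\<int> / m\<close>; it contains a lattice point as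
  soon as its numerators cover \<open>m\<close> consecutive integers.\<close>

lemma lift_lattice_point:
  fixes P :: "(real^3) set" and \<pi> :: "real^3 \<Rightarrow> real^2"
  assumes "convex P" "finite (lattice_points P)" "lattice_projection \<pi>"
    and "k + 1 \<le> card {y \<in> lattice_points P. \<pi> y = p}"
    and "p \<in> int_lattice" "w \<in> int_lattice" "p + real m *\<^sub>R w \<in> \<pi> ` lattice_points P"
    and "0 < j" "j < m" "m \<le> k * (m - j) + 1"
  shows "p + real j *\<^sub>R w \<in> \<pi> ` lattice_points P"
proof -
  obtain h :: "real^3 \<Rightarrow> real" where h: "linear h" "h ` int_lattice \<subseteq> \<int>"
    "\<And>x. \<pi> x \<in> int_lattice \<Longrightarrow> h x \<in> \<int> \<Longrightarrow> x \<in> int_lattice"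
    "\<And>x y. \<pi> x = \<pi> y \<Longrightarrow> h x = h y \<Longrightarrow> x = y"
    using projection_height[OF assms(3)] by blast
  have aff: "affine_map \<pi>" "affine_map h"
    using assms(3) h(1) linear_0[OF h(1)] by (auto simp: lattice_projection_def affine_map_def)
  define F where "F = {y \<in> lattice_points P. \<pi> y = p}"
  have "finite F"
    using assms(2) by (simp add: F_def)
  moreover have "card F \<noteq> 0"
    using assms(4) unfolding F_def by linarith
  ultimately have F: "finite F" "F \<noteq> {}"
    by auto
  have "inj_on h F"
    using h(4) by (auto simp: inj_on_def F_def)
  then have "card (h ` F) \<ge> k + 1"
    using assms(4) by (simp add: card_image F_def)
  moreover have "h ` F \<subseteq> \<int>"
    using h(2) by (auto simp: F_def lattice_points_def)
  ultimately have "real k \<le> Max (h ` F) - Min (h ` F)"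
    using card_Ints_le[of "h ` F"] F by simp
  moreover have "Max (h ` F) \<in> h ` F" "Min (h ` F) \<in> h ` F"
    using F by auto
  ultimately obtain y y' where y: "y \<in> F" "y' \<in> F" "h y' - h y \<ge> real k"
    by (metis imageE)
  obtain x where x: "x \<in> lattice_points P" "\<pi> x = p + real m *\<^sub>R w"
    using assms(7) by auto
  have m: "real m > 0"
    using assms(9) by simp
  define a where "a = real (m - j) / real m"
  define b where "b = real j / real m"
  have ab: "a + b = 1" "0 \<le> a" "0 \<le> b" and a: "a = 1 - b" and bm: "b * real m = real j"
    and am: "a * real m = real (m - j)"
    using assms(9) by (auto simp: a_def b_def field_simps of_nat_diff)
  define N where "N = real (m - j) * h y + real j * h x"
  have "h y \<in> \<int>" "h x \<in> \<int>"
    using y x h(2) by (auto simp: F_def lattice_points_def)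
  then have "N \<in> \<int>"
    by (auto simp: N_def)
  then obtain n where n: "N = of_int n"
    by (auto elim!: Ints_cases)
  \<comment> \<open>The ceiling of \<open>n / m\<close>: the first integer height not below
    \<open>h z = N / m\<close>. Rounding up costs at most \<open>(m - 1) / m\<close>.\<close>
  define c where "c = - ((- n) div int m)"
  have "int m * c \<ge> n" "int m * c \<le> n + int m - 1"
  proof -
    have "int m * ((- n) div int m) + (- n) mod int m = - n"
      by (rule mult_div_mod_eq)
    then have "int m * c = n + (- n) mod int m"
      unfolding c_def mult_minus_right by linarith
    moreover have "0 \<le> (- n) mod int m" "(- n) mod int m \<le> int m - 1"
      using m by auto
    ultimately show "int m * c \<ge> n" "int m * c \<le> n + int m - 1"
      by linarith+
  qed
  then have c: "real_of_int (int m * c) \<ge> N" "real_of_int (int m * c) \<le> N + real m - 1"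
    unfolding n by linarith+
  define z where "z = a *\<^sub>R y + b *\<^sub>R x"
  define z' where "z' = a *\<^sub>R y' + b *\<^sub>R x"
  have hz: "h z * real m = N"
  proof -
    have "h z * real m = (a * real m) * h y + (b * real m) * h x"
      using affine_map_combination2[OF aff(2) ab(1)] by (simp add: z_def algebra_simps)
    then show ?thesis
      by (simp add: am bm N_def)
  qed
  have hz': "h z' * real m \<ge> N + real m - 1"
  proof -
    have "h z' * real m = (a * real m) * h y' + (b * real m) * h x"
      using affine_map_combination2[OF aff(2) ab(1)] by (simp add: z'_def algebra_simps)
    also have "\<dots> = N + real (m - j) * (h y' - h y)"
      by (simp add: am bm N_def algebra_simps)
    finally have "h z' * real m = N + real (m - j) * (h y' - h y)" .
    moreover have "real (m - j) * (h y' - h y) \<ge> real (m - j) * real k"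
      using y(3) by (intro mult_left_mono) auto
    \<comment> \<open>The last hypothesis enters here: the heights of \<open>z\<close> and
      \<open>z'\<close> differ by at least \<open>(m - 1) / m\<close>, just enough to pay for the
      rounding.\<close>
    moreover have "real m \<le> real (k * (m - j) + 1)"
      using assms(10) by (simp only: of_nat_le_iff)
    then have "real (m - j) * real k \<ge> real m - 1"
      by (simp add: mult.commute)
    ultimately show ?thesis by linarith
  qed
  have zP: "z \<in> P" "z' \<in> P"
    using convexD[OF assms(1), of _ x a b] ab y x
    by (auto simp: z_def z'_def F_def lattice_points_def)
  have "\<pi> z = a *\<^sub>R p + b *\<^sub>R (p + real m *\<^sub>R w)" "\<pi> z' = a *\<^sub>R p + b *\<^sub>R (p + real m *\<^sub>R w)"
    using affine_map_combination2[OF aff(1) ab(1)] y x by (auto simp: z_def z'_def F_def)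
  moreover have "a *\<^sub>R p + b *\<^sub>R (p + real m *\<^sub>R w) = p + real j *\<^sub>R w"
    unfolding a by (simp add: algebra_simps bm)
  ultimately have \<pi>z: "\<pi> z = p + real j *\<^sub>R w" "\<pi> z' = p + real j *\<^sub>R w"
    by auto
  have "real_of_int (int m * c) = of_int c * real m"
    by simp
  then have "h z * real m \<le> of_int c * real m" "of_int c * real m \<le> h z' * real m"
    using c hz hz' by linarith+
  then have "h z \<le> of_int c" "of_int c \<le> h z'"
    using m by auto
  then obtain u where u: "0 \<le> u" "u \<le> 1" "of_int c = (1 - u) * h z + u * h z'"
  proof (cases "h z = h z'")
    case True
    then show ?thesis
      using that[of 0] \<open>h z \<le> of_int c\<close> \<open>of_int c \<le> h z'\<close> by simp
  next
    case False
    then have "h z' - h z > 0"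
      using \<open>h z \<le> of_int c\<close> \<open>of_int c \<le> h z'\<close> by linarith
    moreover define r where "r = (of_int c - h z) / (h z' - h z)"
    ultimately have "0 \<le> r" "r \<le> 1" "r * (h z' - h z) = of_int c - h z"
      using \<open>h z \<le> of_int c\<close> \<open>of_int c \<le> h z'\<close> by auto
    then show ?thesis
      using that[of r] by (simp add: algebra_simps)
  qed
  define q where "q = (1 - u) *\<^sub>R z + u *\<^sub>R z'"
  have "h q = of_int c"
    using affine_map_combination2[OF aff(2), of "1 - u" u] u by (simp add: q_def)
  moreover have \<pi>q: "\<pi> q = p + real j *\<^sub>R w"
    using affine_map_combination2[OF aff(1), of "1 - u" u] \<pi>z
    by (simp add: q_def flip: scaleR_add_left)
  moreover have "p + real j *\<^sub>R w \<in> int_lattice"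
    using assms(5,6) by (intro int_lattice_add int_lattice_scaleR) auto
  ultimately have "q \<in> int_lattice"
    using h(3) by simp
  moreover have "q \<in> P"
    using convexD[OF assms(1) zP, of "1 - u" u] u by (simp add: q_def)
  ultimately show ?thesis
    using \<pi>q by (force simp: lattice_points_def)
qed

subsection \<open>Unimodular triangles and their second dilations\<close>

lemma not_collinear_cross2:
  assumes "cross2 (b - a) (c - a) \<noteq> 0"
  shows "\<not> collinear {a, b, c}"
proof
  assume "collinear {a, b, c}"
  then obtain u x y where "b - a = x *\<^sub>R u" "c - a = y *\<^sub>R u"
    unfolding collinear_def by (metis insertCI)
  then show False
    using assms by simp
qed

lemma triangle_simplex:
  fixes a b c :: "real^2"
  assumes "\<not> collinear {a, b, c}"
  shows "aff_dim (convex hull {a, b, c}) = 2" "vertices (convex hull {a, b, c}) = {a, b, c}"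
    "card {a, b, c} = 3"
proof -
  have d: "aff_dim {a, b, c} = 2"
    using assms aff_dim_le_DIM[of "{a, b, c}"] by (auto simp: collinear_aff_dim)
  then show "aff_dim (convex hull {a, b, c}) = 2"
    by (simp add: aff_dim_convex_hull)
  have "a \<noteq> b" "b \<noteq> c" "a \<noteq> c"
    using assms by (auto simp: insert_commute)
  then show card: "card {a, b, c} = 3"
    by simp
  then have "\<not> affine_dependent {a, b, c}"
    using d by (simp add: affine_independent_iff_card)
  then show "vertices (convex hull {a, b, c}) = {a, b, c}"
    by (auto simp: vertices_def extreme_point_of_convex_hull_affine_independent)
qed

lemma lattice_polytope_convex_hull:
  assumes "finite S" "S \<subseteq> int_lattice"
  shows "lattice_polytope (convex hull S)"
  using assms extreme_point_of_convex_hull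
  by (fastforce simp: lattice_polytope_def vertices_def polytope_def)

text \<open>Cramer's rule inverts the linear map with columns \<open>u\<close> and \<open>w\<close>.
  The denominator is their determinant, 1 or -1, so the inverse \<open>\<psi>\<close> preserves the
  lattice as well.\<close>

lemma unimodular_triangle_cross2:
  assumes "u \<in> int_lattice" "w \<in> int_lattice" "\<bar>cross2 u w\<bar> = 1"
  shows "unimodular_triangle (convex hull {0, u, w})"
proof -
  have nc: "\<not> collinear {0, u, w}"
    using assms(3) by (intro not_collinear_cross2) auto
  have "lattice_triangle (convex hull {0, u, w})"
    using assms triangle_simplex[OF nc] lattice_polytope_convex_hull[of "{0, u, w}"]
    by (auto simp: lattice_triangle_def lattice_polygon_def int_lattice_2)
  moreover have "unimodularly_equivalent (convex hull {vector [0, 0], vector [1, 0], vector [0, 1]})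
    (convex hull {0, u, w})"
  proof -
    define \<phi> where "\<phi> x = (x $ 1) *\<^sub>R u + (x $ 2) *\<^sub>R w" for x :: "real^2"
    define \<psi> where "\<psi> x = (vector [cross2 x w / cross2 u w, cross2 u x / cross2 u w] :: real^2)"
      for x :: "real^2"
    have D: "cross2 u w \<noteq> 0"
      using assms(3) by auto
    have lin: "linear \<phi>"
      by (auto simp: linear_iff \<phi>_def algebra_simps)
    have "\<phi> (\<psi> x) = x" for x
    proof -
      have "cross2 x w * u $ i + cross2 u x * w $ i = cross2 u w * x $ i" for i
        using exhaust_2[of i] by (auto simp: cross2_def algebra_simps)
      then show ?thesis
        using D by (simp add: \<phi>_def \<psi>_def vec_eq_iff field_simps)
    qed
    moreover have "\<psi> (\<phi> x) = x" for x
    proof -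
      have "cross2 (\<phi> x) w = x $ 1 * cross2 u w" "cross2 u (\<phi> x) = x $ 2 * cross2 u w"
        by (simp_all add: cross2_def \<phi>_def algebra_simps)
      then show ?thesis
        using D by (simp add: \<psi>_def vec_eq_iff forall_2)
    qed
    moreover have \<phi>_lat: "\<phi> x \<in> int_lattice" if "x \<in> int_lattice" for x
      using that assms(1,2) unfolding \<phi>_def
      by (intro int_lattice_add int_lattice_scaleR) (auto simp: int_lattice_2)
    moreover have "\<psi> x \<in> int_lattice" if "x \<in> int_lattice" for x
    proof -
      have "cross2 u w = 1 \<or> cross2 u w = -1"
        using assms(3) by linarith
      moreover have "cross2 x w \<in> \<int>" "cross2 u x \<in> \<int>"
        using that assms(1,2) by (auto simp: cross2_def int_lattice_2)
      ultimately show ?thesis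
        by (auto simp: \<psi>_def int_lattice_2)
    qed
    ultimately have "bij \<phi>" "\<phi> ` int_lattice = int_lattice"
      by (auto intro!: bij_betw_byWitness[where f' = \<psi>] simp: image_iff) metis
    moreover have "affine_map \<phi>"
      using lin linear_0[OF lin] by (simp add: affine_map_def)
    moreover have "\<phi> ` (convex hull {vector [0, 0], vector [1, 0], vector [0, 1]}) = convex hull {0, u, w}"
      by (simp add: convex_hull_linear_image[OF lin]) (simp add: \<phi>_def)
    ultimately show ?thesis
      by (auto simp: unimodularly_equivalent_def lattice_projection_def)
  qed
  ultimately show ?thesis
    by (simp add: unimodular_triangle_def)
qed

lemma second_dilation_triangle:
  assumes "v1 - v3 = 2 *\<^sub>R u" "v2 - v3 = 2 *\<^sub>R w" "u \<in> int_lattice" "w \<in> int_lattice"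
    and "v3 \<in> int_lattice" "\<bar>cross2 u w\<bar> = 1"
  shows "\<exists>T. unimodular_triangle T \<and> second_dilation_of (convex hull {v1, v2, v3}) T"
proof -
  have "convex hull {v3, v1, v2} = (\<lambda>x. v3 + 2 *\<^sub>R x) ` (convex hull {0, u, w})"
    by (simp flip: convex_hull_affinity assms(1,2))
  then have "second_dilation_of (convex hull {v1, v2, v3}) (convex hull {0, u, w})"
    using assms(5) by (auto simp: second_dilation_of_def insert_commute)
  then show ?thesis
    using unimodular_triangle_cross2[OF assms(3,4,6)] by blast
qed

lemma wide_extent:
  fixes f :: "real^2 \<Rightarrow> real"
  assumes "wide S" "integer_functional f" "f a \<noteq> f b"
  obtains x y where "x \<in> S" "y \<in> S" "f y - f x > 1"
proof -
  have "\<not> f constant_on UNIV"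
    using assms(3) by (metis UNIV_I constant_on_def)
  then show ?thesis
    using assms(1,2) that unfolding wide_def by meson
qed

text \<open>If \<open>(f1, f2)\<close> were not unimodular, then \<open>v1 - p\<close> and \<open>v3 - p\<close> would span the lattice, and the
  functional vanishing on the edge through \<open>v1\<close> and \<open>v2\<close> would show that \<open>S\<close> is not wide.\<close>

lemma second_dilation_midpoint:
  assumes "S \<subseteq> int_lattice" "wide S" "S \<subseteq> convex hull {v1, v2, v3}"
    and "v1 \<in> S" "v2 \<in> S" "v3 \<in> S" "p \<in> S" "v1 + v2 = 2 *\<^sub>R p"
    and "integer_functional f1" "f1 v1 = 2" "f1 v2 = 0" "f1 v3 = 0"
    and "integer_functional f2" "f2 v1 = 0" "f2 v2 = 2" "f2 v3 = 0"
  shows "\<exists>T. unimodular_triangle T \<and> second_dilation_of (convex hull S) T"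
proof -
  obtain s t c where f1: "f1 = (\<lambda>x. s * x $ 1 + t * x $ 2 + c)" "s \<in> \<int>" "t \<in> \<int>"
    using integer_functional_2E[OF assms(9)] by blast
  obtain s' t' c' where f2: "f2 = (\<lambda>x. s' * x $ 1 + t' * x $ 2 + c')" "s' \<in> \<int>" "t' \<in> \<int>"
    using integer_functional_2E[OF assms(13)] by blast
  define d where "d = s * t' - t * s'"
  define a where "a = v1 - v3"
  define b where "b = v2 - v3"
  have a: "s * a $ 1 + t * a $ 2 = 2" "s' * a $ 1 + t' * a $ 2 = 0"
    using assms(10-16) by (auto simp: f1 f2 a_def algebra_simps)
  have b: "s * b $ 1 + t * b $ 2 = 0" "s' * b $ 1 + t' * b $ 2 = 2"
    using assms(10-16) by (auto simp: f1 f2 b_def algebra_simps)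
  \<comment> \<open>Multiplicativity of determinants: the linear parts of \<open>f1\<close> and
    \<open>f2\<close> send \<open>a\<close> and \<open>b\<close> to twice the unit vectors, and
    \<open>d\<close> is the determinant of these linear parts.\<close>
  have dab: "d * cross2 a b = 4"
  proof -
    have "d * cross2 a b = (s * a $ 1 + t * a $ 2) * (s' * b $ 1 + t' * b $ 2)
        - (s' * a $ 1 + t' * a $ 2) * (s * b $ 1 + t * b $ 2)"
      by (simp add: d_def cross2_def algebra_simps)
    then show ?thesis
      by (simp add: a b)
  qed
  \<comment> \<open>As \<open>g\<close> vanishes at \<open>v1\<close> and \<open>v2\<close>, its
    extent on \<open>S\<close> is \<open>\<bar>g v3\<bar>\<close>, half of
    \<open>\<bar>cross2 a b\<bar>\<close>. Wideness makes the latter exceed 2, which leaves only 1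
    and -1 for the integer \<open>d\<close>.\<close>
  define g where "g x = cross2 (v1 - p) (x - p)" for x
  have p: "p = (1/2) *\<^sub>R v1 + (1/2) *\<^sub>R v2"
    using assms(8) by (simp flip: scaleR_add_right)
  have g_int: "integer_functional g"
    unfolding g_def using assms(1,4,7)
    by (intro integer_functional_cross2) (auto intro: int_lattice_diff)
  have gv: "g v1 = 0" "g v2 = 0" "2 * g v3 = - cross2 a b"
    by (simp_all add: g_def p cross2_def a_def b_def field_simps)
  have "g v3 \<noteq> g v1"
    using gv dab by auto
  from wide_extent[OF assms(2) g_int this]
  obtain x y where xy: "x \<in> S" "y \<in> S" "g y - g x > 1" .
  have "g z \<le> max 0 (g v3)" "min 0 (g v3) \<le> g z" if "z \<in> S" for z
  proof -
    have "z \<in> convex hull {v1, v2, v3}"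
      using that assms(3) by blast
    from affine_map_le_hull[OF integer_functional_affine[OF g_int] this, of "max 0 (g v3)"]
      affine_map_ge_hull[OF integer_functional_affine[OF g_int] this, of "min 0 (g v3)"]
    show "g z \<le> max 0 (g v3)" "min 0 (g v3) \<le> g z"
      using gv(1,2) by fastforce+
  qed
  from this[OF xy(1)] this[OF xy(2)] have "\<bar>g v3\<bar> > 1"
    using xy(3) by (auto simp: max_def min_def split: if_splits)
  then have "\<bar>cross2 a b\<bar> > 2"
    using gv(3) by linarith
  moreover have "\<bar>d\<bar> * \<bar>cross2 a b\<bar> = 4"
    using dab by (simp flip: abs_mult)
  ultimately have "\<bar>d\<bar> * 2 < 4" if "d \<noteq> 0"
    using that mult_strict_left_mono[of 2 "\<bar>cross2 a b\<bar>" "\<bar>d\<bar>"] by simp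
  moreover have "d \<noteq> 0" "d \<in> \<int>"
    using dab f1 f2 by (auto simp: d_def)
  moreover from \<open>d \<in> \<int>\<close> obtain z where z: "d = of_int z"
    by (elim Ints_cases)
  ultimately have "\<bar>z\<bar> < 2" "z \<noteq> 0"
    by (auto simp flip: of_int_abs)
  then have "z = 1 \<or> z = -1"
    by linarith
  then have "d = 1 \<or> d = -1"
    using z by auto
  then have dd: "d * d = 1"
    by auto
  \<comment> \<open>\<open>u\<close> and \<open>w\<close> are the columns of the inverse of the
    matrix of linear parts; as \<open>d\<close> is 1 or -1, division by \<open>d\<close> is written
    as multiplication.\<close>
  define u where "u = (vector [d * t', - (d * s')] :: real^2)"
  define w where "w = (vector [- (d * t), d * s] :: real^2)"
  have "d * a $ 1 = t' * (s * a $ 1 + t * a $ 2) - t * (s' * a $ 1 + t' * a $ 2)"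
    "d * a $ 2 = s * (s' * a $ 1 + t' * a $ 2) - s' * (s * a $ 1 + t * a $ 2)"
    by (simp_all add: d_def algebra_simps)
  then have "d * (d * a $ 1) = d * (2 * t')" "d * (d * a $ 2) = d * (- 2 * s')"
    by (simp_all add: a)
  then have au: "a = 2 *\<^sub>R u"
    by (simp add: u_def vec_eq_iff forall_2 dd flip: mult.assoc)
  have "d * b $ 1 = t' * (s * b $ 1 + t * b $ 2) - t * (s' * b $ 1 + t' * b $ 2)"
    "d * b $ 2 = s * (s' * b $ 1 + t' * b $ 2) - s' * (s * b $ 1 + t * b $ 2)"
    by (simp_all add: d_def algebra_simps)
  then have "d * (d * b $ 1) = d * (- 2 * t)" "d * (d * b $ 2) = d * (2 * s)"
    by (simp_all add: b)
  then have bw: "b = 2 *\<^sub>R w"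
    by (simp add: w_def vec_eq_iff forall_2 dd flip: mult.assoc)
  have "cross2 u w = (d * d) * d"
    by (simp add: cross2_def u_def w_def d_def algebra_simps)
  then have cuw: "\<bar>cross2 u w\<bar> = 1"
    using dd \<open>d = 1 \<or> d = -1\<close> by auto
  have uw: "u \<in> int_lattice" "w \<in> int_lattice"
    using \<open>d \<in> \<int>\<close> f1 f2 by (auto simp: int_lattice_2 u_def w_def)
  have "convex hull S = convex hull {v1, v2, v3}"
    using assms(3-6) by (intro subset_antisym hull_minimal hull_mono) auto
  then show ?thesis
    using second_dilation_triangle[of v1 v3 u v2 w] au bw cuw uw assms(1,6)
    by (auto simp: a_def b_def)
qed

subsection \<open>Configurations with three separated points\<close>

lemma midpoint_in_hull:
  assumes "2 *\<^sub>R x = a + b" "a \<in> convex hull S" "b \<in> convex hull S"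
  shows "x \<in> convex hull S"
proof -
  have "x = (1/2) *\<^sub>R a + (1/2) *\<^sub>R b"
    using assms(1) by (simp flip: scaleR_add_right assms(1))
  then show ?thesis
    using convexD[OF convex_convex_hull assms(2,3), of "1/2" "1/2"] by simp
qed

lemma separates_affine: "separates f v S \<Longrightarrow> affine_map f"
  by (simp add: separates_def integer_functional_affine)

text \<open>Let \<open>k\<close> be the ratio of the two functionals, measured from the third point
  \<open>w\<close>. If \<open>f1\<close> increased from \<open>w\<close> to \<open>v2\<close>, then
  \<open>k \<ge> 1\<close>, and the large value of \<open>f1\<close> at \<open>v1\<close> would push
  \<open>f2 v1\<close> to 2. So it drops by one, which gives \<open>k \<le> -1\<close> at
  \<open>v2\<close>, while \<open>v1\<close> gives \<open>k \<ge> -1\<close>; both functionals are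
  then 1 at \<open>w\<close>.\<close>

lemma separates_parallel:
  assumes "separates f1 v1 S" "separates f2 v2 S" "v1 \<in> S" "v2 \<in> S" "v1 \<noteq> v2"
    and "w \<in> S" "w \<noteq> v1" "w \<noteq> v2" "x \<noteq> y" "f1 x = f1 y" "f2 x = f2 y"
  shows "f1 z + f2 z = 2"
proof -
  have f1: "f1 v1 \<ge> 2" "f1 v2 = 0 \<or> f1 v2 = 1" "f1 w = 0 \<or> f1 w = 1"
    using assms by (auto simp: separates_def)
  have f2: "f2 v2 \<ge> 2" "f2 v1 = 0 \<or> f2 v1 = 1" "f2 w = 0 \<or> f2 w = 1"
    using assms by (auto simp: separates_def)
  have "f1 v1 \<noteq> f1 w"
    using f1 by auto
  from affine_proportional[OF separates_affine[OF assms(1)] separates_affine[OF assms(2)]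
      assms(9-11) this]
  obtain k where "\<forall>z. f2 z - f2 x = k * (f1 z - f1 x)"
    by blast
  then have k: "f2 z - f2 w = k * (f1 z - f1 w)" for z
    by (smt (verit) right_diff_distrib)
  have "f1 v2 - f1 w = -1"
  proof -
    have "f1 v2 - f1 w \<noteq> 0"
      using k[of v2] f2 by auto
    moreover have "f1 v2 - f1 w \<noteq> 1"
    proof
      assume *: "f1 v2 - f1 w = 1"
      then have "k \<ge> 1" "f1 w = 0"
        using k[of v2] f1 f2 by auto
      then have "k * (f1 v1 - f1 w) \<ge> 1 * 2"
        using f1 by (intro mult_mono) auto
      then show False
        using k[of v1] f2 by auto
    qed
    ultimately show ?thesis
      using f1 by auto
  qed
  then have w: "f1 w = 1" "k \<le> -1"
    using f1 k[of v2] f2 by auto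
  have "(- k) * (f1 v1 - f1 w) \<ge> - k * 1"
    using f1 w by (intro mult_left_mono) auto
  then have "f2 v1 - f2 w \<le> k"
    using k[of v1] by simp
  then have "k = -1" "f2 w = 1"
    using w f2 by auto
  then show ?thesis
    using k[of z] w by simp
qed

text \<open>Symmetric in the three indices: lemmas are proved for one ordering and reused through
  \<open>swap12\<close>, \<open>swap23\<close> and \<open>rotate\<close>. Only separation is
  recorded, as that is all the arguments in the plane use of an essential vertex.\<close>

locale three_separated =
  fixes S :: "(real^2) set" and v1 v2 v3 :: "real^2" and f1 f2 f3 :: "real^2 \<Rightarrow> real"
  assumes finite: "finite S" and lattice: "S \<subseteq> int_lattice" and wide: "wide S"
    and mem: "v1 \<in> S" "v2 \<in> S" "v3 \<in> S"
    and distinct: "v1 \<noteq> v2" "v1 \<noteq> v3" "v2 \<noteq> v3"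
    and sep: "separates f1 v1 S" "separates f2 v2 S" "separates f3 v3 S"
begin

lemma swap12: "three_separated S v2 v1 v3 f2 f1 f3"
  and swap23: "three_separated S v1 v3 v2 f1 f3 f2"
  and rotate: "three_separated S v2 v3 v1 f2 f3 f1"
  using finite lattice wide mem distinct sep by (auto simp: three_separated_def)

lemma functionals: "integer_functional f1" "integer_functional f2" "integer_functional f3"
  using sep by (auto simp: separates_def)

lemma affine: "affine_map f1" "affine_map f2" "affine_map f3"
  using sep separates_affine by auto

lemma large: "f1 v1 \<ge> 2" "f2 v2 \<ge> 2" "f3 v3 \<ge> 2"
  using sep by (auto simp: separates_def)

lemma zero_one:
  "x \<in> S \<Longrightarrow> x \<noteq> v1 \<Longrightarrow> f1 x = 0 \<or> f1 x = 1"
  "x \<in> S \<Longrightarrow> x \<noteq> v2 \<Longrightarrow> f2 x = 0 \<or> f2 x = 1"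
  "x \<in> S \<Longrightarrow> x \<noteq> v3 \<Longrightarrow> f3 x = 0 \<or> f3 x = 1"
  using sep by (auto simp: separates_def)

text \<open>Mostly used in the contrapositive: unless \<open>f1\<close> and \<open>f2\<close> add up
  to 2, the pair \<open>(f1, f2)\<close> is injective on the whole plane. The point
  \<open>v3\<close> serves as the \<open>w\<close> of \<open>separates_parallel\<close>.\<close>

lemma parallel_opposite:
  assumes "x \<noteq> y" "f1 x = f1 y" "f2 x = f2 y"
  shows "f1 z + f2 z = 2"
  using separates_parallel[OF sep(1,2) mem(1,2) distinct(1) mem(3) _ _ assms] distinct by auto

lemma opposite_values:
  assumes "\<And>z. f1 z + f2 z = 2"
  shows "f1 v1 = 2" "f1 v2 = 0" "f1 v3 = 1" "x \<in> S \<Longrightarrow> x \<noteq> v1 \<Longrightarrow> x \<noteq> v2 \<Longrightarrow> f1 x = 1"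
  using assms[of v1] assms[of v2] assms[of v3] assms[of x] large distinct mem
    zero_one(1)[of v2] zero_one(1)[of v3] zero_one(1)[of x]
    zero_one(2)[of v1] zero_one(2)[of v3] zero_one(2)[of x]
  by auto

text \<open>The first sum gives \<open>f1 v3 = 1\<close>, so the second would give
  \<open>f3 v3 = 1\<close>. Hence \<open>(f1, f3)\<close> are injective coordinates when
  \<open>f1\<close> and \<open>f2\<close> are opposite.\<close>

lemma not_opposite_13:
  assumes "\<And>z. f1 z + f2 z = 2"
  shows "\<not> (\<forall>z. f1 z + f3 z = 2)"
  using opposite_values(3)[OF assms] large(3) by (auto intro!: exI[of _ v3])

text \<open>Otherwise all three points lie on the line \<open>f1 = 1\<close>, and \<open>f3\<close>
  has only two values for them, so two points agree in the coordinates
  \<open>(f1, f3)\<close>.\<close>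

lemma not_opposite_if_three:
  assumes "w1 \<in> S - {v1, v2, v3}" "w2 \<in> S - {v1, v2, v3}" "w3 \<in> S - {v1, v2, v3}"
    and "w1 \<noteq> w2" "w1 \<noteq> w3" "w2 \<noteq> w3"
  shows "\<not> (\<forall>z. f1 z + f2 z = 2)"
proof
  assume opp: "\<forall>z. f1 z + f2 z = 2"
  interpret s: three_separated S v1 v3 v2 f1 f3 f2
    by (rule swap23)
  have "f1 w1 = 1" "f1 w2 = 1" "f1 w3 = 1"
    using opposite_values(4) opp assms by auto
  moreover have "f3 w1 = f3 w2 \<or> f3 w1 = f3 w3 \<or> f3 w2 = f3 w3"
    using zero_one(3)[of w1] zero_one(3)[of w2] zero_one(3)[of w3] assms by auto
  ultimately show False
    using s.parallel_opposite assms(4-6) not_opposite_13 opp by metis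
qed

text \<open>The injective \<open>(f1, f2)\<close> sends the three points and \<open>v3\<close> onto
  the corners of the unit square, which leaves no corner for a further point. A corner is the sum of
  its neighbours minus the opposite corner, here \<open>a\<close>; written symmetrically in the
  three points, the equation can be compared with its rotations.\<close>

lemma corner:
  assumes "w1 \<in> S - {v1, v2, v3}" "w2 \<in> S - {v1, v2, v3}" "w3 \<in> S - {v1, v2, v3}"
    and "w1 \<noteq> w2" "w1 \<noteq> w3" "w2 \<noteq> w3"
  shows "\<exists>a\<in>{w1, w2, w3}. v3 = w1 + w2 + w3 - 2 *\<^sub>R a" "S - {v1, v2, v3} \<subseteq> {w1, w2, w3}"
proof -
  have inj: "x = y" if "f1 x = f1 y" "f2 x = f2 y" for x y
    using that parallel_opposite not_opposite_if_three[OF assms] by blast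
  have comb: "f1 (a + b - c) = f1 a + f1 b - f1 c" "f2 (a + b - c) = f2 a + f2 b - f2 c" for a b c
    using affine_map_combination[OF affine(1), of 1 1 "-1" a b c]
      affine_map_combination[OF affine(2), of 1 1 "-1" a b c] by auto
  have val: "f1 x = 0 \<or> f1 x = 1" "f2 x = 0 \<or> f2 x = 1" if "x \<in> S - {v1, v2}" for x
    using that zero_one by auto
  have in_S: "w1 \<in> S - {v1, v2}" "w2 \<in> S - {v1, v2}" "w3 \<in> S - {v1, v2}" "v3 \<in> S - {v1, v2}"
    using assms mem distinct by auto
  have ne: "\<not> (f1 w1 = f1 w2 \<and> f2 w1 = f2 w2)" "\<not> (f1 w1 = f1 w3 \<and> f2 w1 = f2 w3)"
    "\<not> (f1 w2 = f1 w3 \<and> f2 w2 = f2 w3)" "\<not> (f1 w1 = f1 v3 \<and> f2 w1 = f2 v3)"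
    "\<not> (f1 w2 = f1 v3 \<and> f2 w2 = f2 v3)" "\<not> (f1 w3 = f1 v3 \<and> f2 w3 = f2 v3)"
    using inj assms by blast+
  have "(f1 v3 = f1 w1 + f1 w2 - f1 w3 \<and> f2 v3 = f2 w1 + f2 w2 - f2 w3) \<or>
    (f1 v3 = f1 w1 + f1 w3 - f1 w2 \<and> f2 v3 = f2 w1 + f2 w3 - f2 w2) \<or>
    (f1 v3 = f1 w2 + f1 w3 - f1 w1 \<and> f2 v3 = f2 w2 + f2 w3 - f2 w1)"
    using val[OF in_S(1)] val[OF in_S(2)] val[OF in_S(3)] val[OF in_S(4)] ne
    by (elim disjE) simp_all
  then have "v3 = w1 + w2 - w3 \<or> v3 = w1 + w3 - w2 \<or> v3 = w2 + w3 - w1"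
    using inj comb by metis
  then show "\<exists>a\<in>{w1, w2, w3}. v3 = w1 + w2 + w3 - 2 *\<^sub>R a"
    by (auto simp: scaleR_2 algebra_simps)
  show "S - {v1, v2, v3} \<subseteq> {w1, w2, w3}"
  proof
    fix x assume x: "x \<in> S - {v1, v2, v3}"
    then have "f1 x = 0 \<or> f1 x = 1" "f2 x = 0 \<or> f2 x = 1"
      using val by auto
    then have "(f1 x = f1 w1 \<and> f2 x = f2 w1) \<or> (f1 x = f1 w2 \<and> f2 x = f2 w2) \<or>
      (f1 x = f1 w3 \<and> f2 x = f2 w3) \<or> (f1 x = f1 v3 \<and> f2 x = f2 v3)"
      using val[OF in_S(1)] val[OF in_S(2)] val[OF in_S(3)] val[OF in_S(4)] ne
      by (elim disjE) simp_all
    then show "x \<in> {w1, w2, w3}"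
      using inj x by blast
  qed
qed

lemma six_points:
  assumes "card (S - {v1, v2, v3}) \<ge> 3"
  shows "\<exists>T. unimodular_triangle T \<and> second_dilation_of (convex hull S) T"
proof -
  obtain W where W: "W \<subseteq> S - {v1, v2, v3}" "card W = 3"
    using assms by (meson obtain_subset_with_card_n)
  then obtain w1 w2 w3 where w: "W = {w1, w2, w3}" "w1 \<noteq> w2" "w1 \<noteq> w3" "w2 \<noteq> w3"
    by (auto simp: card_3_iff)
  have w_in: "w1 \<in> S - {v1, v2, v3}" "w2 \<in> S - {v1, v2, v3}" "w3 \<in> S - {v1, v2, v3}"
    using W w by auto
  let ?s = "w1 + w2 + w3"
  interpret r: three_separated S v2 v3 v1 f2 f3 f1
    by (rule rotate)
  interpret rr: three_separated S v3 v1 v2 f3 f1 f2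
    by (rule r.rotate)
  obtain c where c: "c \<in> {w1, w2, w3}" "v3 = ?s - 2 *\<^sub>R c"
    using corner(1)[OF w_in w(2-4)] by blast
  obtain a where a: "a \<in> {w1, w2, w3}" "v1 = ?s - 2 *\<^sub>R a"
    using r.corner(1)[of w1 w2 w3] w_in w(2-4) by blast
  obtain b where b: "b \<in> {w1, w2, w3}" "v2 = ?s - 2 *\<^sub>R b"
    using rr.corner(1)[of w1 w2 w3] w_in w(2-4) by blast
  \<comment> \<open>Distinct vertices have distinct opposite corners, so these exhaust
    \<open>w1\<close>, \<open>w2\<close>, \<open>w3\<close> and turn out to be the edge
    midpoints.\<close>
  have abc: "a \<noteq> b" "a \<noteq> c" "b \<noteq> c"
    using a b c distinct by auto
  then have s: "?s = a + b + c" and set: "{w1, w2, w3} = {a, b, c}"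
    using a(1) b(1) c(1) w(2-4) by (auto simp: algebra_simps)
  have v: "v1 = b + c - a" "v2 = a + c - b" "v3 = a + b - c"
    using a(2) b(2) c(2) unfolding s by (auto simp: scaleR_2 algebra_simps)
  have val: "f1 x = 0 \<or> f1 x = 1" "f2 x = 0 \<or> f2 x = 1" if "x \<in> {a, b, c}" for x
    using that w_in zero_one unfolding set[symmetric] by auto
  have comb: "f1 (a + b - c) = f1 a + f1 b - f1 c" "f2 (a + b - c) = f2 a + f2 b - f2 c" for a b c
    using affine_map_combination[OF affine(1), of 1 1 "-1" a b c]
      affine_map_combination[OF affine(2), of 1 1 "-1" a b c] by auto
  \<comment> \<open>With values 0 and 1, \<open>f1 b + f1 c - f1 a\<close> reaches 2 only if
    \<open>f1 b = f1 c = 1\<close> and \<open>f1 a = 0\<close>.\<close>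
  have f1: "f1 v1 = 2" "f1 v2 = 0" "f1 v3 = 0"
    using large(1) val(1)[of a] val(1)[of b] val(1)[of c] unfolding v comb by auto
  have f2: "f2 v1 = 0" "f2 v2 = 2" "f2 v3 = 0"
    using large(2) val(2)[of a] val(2)[of b] val(2)[of c] unfolding v comb by auto
  have mids: "2 *\<^sub>R a = v2 + v3" "2 *\<^sub>R b = v1 + v3" "2 *\<^sub>R c = v1 + v2"
    by (auto simp: v scaleR_2)
  have "S \<subseteq> convex hull {v1, v2, v3}"
  proof
    fix x assume "x \<in> S"
    then have "x \<in> {v1, v2, v3} \<union> {a, b, c}"
      using corner(2)[OF w_in w(2-4)] set by auto
    then show "x \<in> convex hull {v1, v2, v3}"
      by (auto intro: hull_inc midpoint_in_hull[OF mids(1)] midpoint_in_hull[OF mids(2)]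
          midpoint_in_hull[OF mids(3)])
  qed
  moreover have "c \<in> S"
    using c(1) w_in by auto
  ultimately show ?thesis
    using second_dilation_midpoint[OF lattice wide _ mem, of c f1 f2] f1 f2 functionals mids(3) by simp
qed

end

subsection \<open>Interior and boundary lattice points\<close>

lemma max_not_interior:
  fixes f :: "'a::euclidean_space \<Rightarrow> real"
  assumes "affine_map f" "f a \<noteq> f x" "\<And>y. y \<in> S \<Longrightarrow> f y \<le> f x"
  shows "x \<notin> interior S"
proof
  assume "x \<in> interior S"
  then obtain e where e: "e > 0" "ball x e \<subseteq> S"
    by (auto simp: mem_interior)
  define n where "n = norm (a - x) + 1"
  define t where "t = e / (2 * n)"
  have n: "n > 0" "norm (a - x) \<le> n"
    using norm_ge_zero[of "a - x"] by (auto simp: n_def simp del: norm_ge_zero)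
  have t: "t > 0" "t * norm (a - x) < e"
  proof -
    show "t > 0"
      using e(1) n by (simp add: t_def)
    have "t * norm (a - x) \<le> t * n"
      using \<open>t > 0\<close> n by simp
    also have "\<dots> = e / 2"
      using n by (simp add: t_def)
    finally show "t * norm (a - x) < e"
      using e(1) by simp
  qed
  have "f ((1 - s) *\<^sub>R x + s *\<^sub>R a) \<le> f x" if "s = t \<or> s = - t" for s
  proof -
    have "dist x ((1 - s) *\<^sub>R x + s *\<^sub>R a) = \<bar>s\<bar> * norm (a - x)"
      by (simp add: dist_norm algebra_simps norm_minus_commute flip: norm_scaleR)
    then show ?thesis
      using e(2) t that by (intro assms(3)) (auto simp: subset_iff)
  qed
  from this[of t] this[of "- t"]
  have "(1 - t) * f x + t * f a \<le> f x" "(1 + t) * f x - t * f a \<le> f x"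
    using affine_map_combination2[OF assms(1), of "1 - t" t x a]
      affine_map_combination2[OF assms(1), of "1 + t" "- t" x a] by auto
  then have "t * (f a - f x) \<le> 0" "t * (f x - f a) \<le> 0"
    by (simp_all add: algebra_simps)
  then show False
    using t(1) assms(2) by (auto simp: mult_le_0_iff)
qed

text \<open>If the interior is empty, \<open>S\<close> lies in a hyperplane, whose normal has
  constant inner product on \<open>S\<close>; otherwise there is a supporting hyperplane at
  \<open>x\<close>. Either contradicts the hypothesis on \<open>a\<close>.\<close>

lemma interior_if_not_supported:
  fixes S :: "'a::euclidean_space set"
  assumes "convex S" "x \<in> S" "\<And>a. \<forall>y\<in>S. a \<bullet> x \<le> a \<bullet> y \<Longrightarrow> a = 0"
  shows "x \<in> interior S"
proof (rule ccontr)
  assume x: "x \<notin> interior S"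
  show False
  proof (cases "interior S = {}")
    case True
    then obtain a b where "a \<noteq> 0" "S \<subseteq> {x. a \<bullet> x = b}"
      using empty_interior_subset_hyperplane[OF assms(1) True] by metis
    then have "a \<bullet> y = b" if "y \<in> S" for y
      using that by blast
    then have "\<forall>y\<in>S. a \<bullet> x \<le> a \<bullet> y"
      using assms(2) by simp
    then show False
      using assms(3) \<open>a \<noteq> 0\<close> by blast
  next
    case False
    then have "x \<notin> rel_interior S"
      using x by (simp add: rel_interior_nonempty_interior)
    then show False
      using supporting_hyperplane_rel_boundary[OF assms(1,2)] assms(3) by metis
  qed
qed

lemma hull_unique_max:
  fixes f :: "'a::real_vector \<Rightarrow> real"
  assumes "affine_map f" "v \<in> S" "\<And>y. y \<in> S \<Longrightarrow> y \<noteq> v \<Longrightarrow> f y < f v"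
    and "x \<in> convex hull S" "f x = f v"
  shows "x = v"
proof (cases "S - {v} = {}")
  case True
  then have "S = {v}"
    using assms(2) by auto
  then show ?thesis
    using assms(4) by simp
next
  case False
  have S: "S = insert v (S - {v})"
    using assms(2) by auto
  obtain u w b where b: "0 \<le> u" "0 \<le> w" "u + w = 1" "b \<in> convex hull (S - {v})" "x = u *\<^sub>R v + w *\<^sub>R b"
    using assms(4) unfolding S[symmetric]
    by (subst (asm) S, subst (asm) convex_hull_insert[OF False]) auto
  have "convex {y. f y < f v}"
  proof (rule convexI)
    fix y z and c d :: real
    assume *: "y \<in> {y. f y < f v}" "z \<in> {y. f y < f v}" "0 \<le> c" "0 \<le> d" "c + d = 1"
    then have "c * f y + d * f z < f v"
      by (intro convex_bound_lt) auto
    then show "c *\<^sub>R y + d *\<^sub>R z \<in> {y. f y < f v}"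
      using affine_map_combination2[OF assms(1) *(5)] by simp
  qed
  then have "convex hull (S - {v}) \<subseteq> {y. f y < f v}"
    using assms(3) by (intro hull_minimal) auto
  then have "f b < f v"
    using b(4) by auto
  moreover have "f v = u * f v + w * f b"
    using affine_map_combination2[OF assms(1) b(3)] b(5) assms(5) by simp
  moreover have "w * (f v - f b) = (u + w) * f v - (u * f v + w * f b)"
    by (simp add: algebra_simps)
  ultimately have "w * (f v - f b) = 0"
    using b(3) by simp
  then have "w = 0"
    using \<open>f b < f v\<close> by simp
  then show ?thesis
    using b by simp
qed

subsection \<open>Two opposite separating functionals\<close>

text \<open>In the application, \<open>F p\<close> is the number of lattice points of \<open>P\<close> projecting to \<open>p\<close>.\<close>

definition liftable :: "(real^2 \<Rightarrow> nat) \<Rightarrow> (real^2) set \<Rightarrow> bool" where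
  "liftable F S \<longleftrightarrow> (\<forall>p w m j k. k + 1 \<le> F p \<longrightarrow> p \<in> int_lattice \<longrightarrow> w \<in> int_lattice \<longrightarrow>
     p + real m *\<^sub>R w \<in> S \<longrightarrow> 0 < j \<longrightarrow> j < m \<longrightarrow> m \<le> k * (m - j) + 1 \<longrightarrow> p + real j *\<^sub>R w \<in> S)"

lemma liftableD:
  assumes "liftable F S" "k + 1 \<le> F p" "p \<in> int_lattice" "w \<in> int_lattice"
    "p + real m *\<^sub>R w \<in> S" "0 < j" "j < m" "m \<le> k * (m - j) + 1"
  shows "p + real j *\<^sub>R w \<in> S"
  using assms unfolding liftable_def by blast

context three_separated begin

text \<open>On the line \<open>f1 = 1\<close> the points \<open>p\<close>, \<open>q\<close>,
  \<open>v3\<close> have heights 0, 1 and \<open>m\<close> under \<open>f3\<close>, so for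
  \<open>m \<ge> 3\<close> height 2 is missing from \<open>S\<close>. But lifting fills it: from
  \<open>q\<close> with \<open>k = 1\<close> if its fibre has two points, and otherwise from
  \<open>p\<close> with \<open>k = 2\<close>, where the condition
  \<open>m \<le> 2 * (m - 2) + 1\<close> is just \<open>m \<ge> 3\<close>.\<close>

lemma opposite_height_two:
  assumes opp: "\<And>z. f1 z + f2 z = 2"
    and S: "S = {v1, v2, v3, p, q}" and pq: "p \<notin> {v1, v2, v3}" "q \<notin> {v1, v2, v3}"
    and f3: "f3 p = 0" "f3 q = 1"
    and lift: "liftable F S" "F p + F q \<ge> 4"
  shows "f3 v3 = 2" "p + v3 = 2 *\<^sub>R q"
proof -
  interpret s: three_separated S v1 v3 v2 f1 f3 f2
    by (rule swap23)
  have inj: "x = y" if "f1 x = f1 y" "f3 x = f3 y" for x y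
    using that s.parallel_opposite not_opposite_13[OF opp] by blast
  have f1: "f1 v1 = 2" "f1 v2 = 0" "f1 v3 = 1" "f1 p = 1" "f1 q = 1"
    using opposite_values[OF opp] S pq by auto
  have "f3 v3 \<in> \<int>"
    using mem lattice integer_functional_Ints[OF functionals(3)] by auto
  then obtain i where "f3 v3 = of_int i"
    by (elim Ints_cases)
  then obtain m where m: "f3 v3 = real m" "m \<ge> 2"
    using large(3) that[of "nat i"] by auto
  define w where "w = q - p"
  have lat: "p \<in> int_lattice" "q \<in> int_lattice" "w \<in> int_lattice"
    using lattice S int_lattice_diff by (auto simp: w_def)
  have w: "p + a *\<^sub>R w = (1 - a) *\<^sub>R p + a *\<^sub>R q" for a
    by (simp add: w_def algebra_simps)
  have line: "f1 (p + a *\<^sub>R w) = 1" "f3 (p + a *\<^sub>R w) = a" for a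
    using affine_map_combination2[OF affine(1), of "1 - a" a p q]
      affine_map_combination2[OF affine(3), of "1 - a" a p q] f1 f3
    by (auto simp: w)
  have v3: "v3 = p + real m *\<^sub>R w"
    by (rule inj) (use line f1 m in auto)
  have "\<not> m \<ge> 3"
  proof
    assume m3: "m \<ge> 3"
    have "p + 2 *\<^sub>R w \<in> S"
    proof (cases "F q \<ge> 2")
      case True
      have "q + real (m - 1) *\<^sub>R w = v3"
        unfolding v3 using m by (simp add: w_def of_nat_diff algebra_simps)
      then have "q + real (m - 1) *\<^sub>R w \<in> S"
        using mem(3) by (simp only:)
      then have "q + real 1 *\<^sub>R w \<in> S"
        using True m3 by (intro liftableD[OF lift(1) _ lat(2,3), of 1 "m - 1" 1]) linarith+
      then show ?thesis
        by (simp add: w_def algebra_simps scaleR_2)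
    next
      case False
      moreover have "p + real m *\<^sub>R w \<in> S"
        using mem(3) unfolding v3 .
      ultimately have "p + real 2 *\<^sub>R w \<in> S"
        using lift(2) m3 by (intro liftableD[OF lift(1) _ lat(1,3), of 2 m 2]) linarith+
      then show ?thesis
        by simp
    qed
    then show False
      using line[of 2] f1 f3 m m3 unfolding S by auto
  qed
  then have "m = 2"
    using m by simp
  then show "f3 v3 = 2"
    using m(1) by simp
  show "p + v3 = 2 *\<^sub>R q"
    using v3 \<open>m = 2\<close> by (simp add: w_def algebra_simps scaleR_2)
qed

text \<open>The integer coordinates \<open>(f1, f3)\<close> confine the lattice points of the hull
  to three columns: \<open>f1 = 0\<close> and \<open>f1 = 2\<close> meet the hull only in
  \<open>v2\<close> and \<open>v1\<close>, and \<open>f1 = 1\<close> leaves \<open>p\<close>,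
  \<open>q\<close>, \<open>v3\<close>. The point \<open>p\<close> may be a vertex or the midpoint of
  \<open>v1\<close> and \<open>v2\<close>; it is a boundary point either way.\<close>

lemma opposite_polygon:
  assumes opp: "\<And>z. f1 z + f2 z = 2"
    and S: "S = {v1, v2, v3, p, q}" and pq: "p \<notin> {v1, v2, v3}" "q \<notin> {v1, v2, v3}"
    and f3: "f3 p = 0" "f3 q = 1" "f3 v3 = 2" and mid: "p + v3 = 2 *\<^sub>R q"
  shows "S = lattice_points (convex hull S)"
    "card (lattice_points (frontier (convex hull S))) = 4"
    "card (lattice_points (interior (convex hull S))) = 1"
proof -
  let ?H = "convex hull S"
  interpret s: three_separated S v1 v3 v2 f1 f3 f2
    by (rule swap23)
  have inj: "x = y" if "f1 x = f1 y" "f3 x = f3 y" for x y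
    using that s.parallel_opposite not_opposite_13[OF opp] by blast
  have f1: "f1 v1 = 2" "f1 v2 = 0" "f1 v3 = 1" "f1 p = 1" "f1 q = 1"
    using opposite_values[OF opp] S pq by auto
  have f3': "f3 v1 = 0 \<or> f3 v1 = 1" "f3 v2 = 0 \<or> f3 v2 = 1"
    using zero_one(3) mem distinct by auto
  have f2: "f2 z = 2 - f1 z" for z
    using opp[of z] by simp
  have bounds: "0 \<le> f1 x" "f1 x \<le> 2" "0 \<le> f3 x" "f3 x \<le> 2" if "x \<in> ?H" for x
    using that f1 f3 f3' unfolding S
    by (auto intro: affine_map_le_hull[OF affine(1)] affine_map_ge_hull[OF affine(1)]
        affine_map_le_hull[OF affine(3)] affine_map_ge_hull[OF affine(3)])
  show lat: "S = lattice_points ?H"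
  proof (intro subset_antisym subsetI)
    fix x assume "x \<in> S"
    then show "x \<in> lattice_points ?H"
      using lattice by (auto simp: lattice_points_def intro: hull_inc)
  next
    fix x assume "x \<in> lattice_points ?H"
    then have x: "x \<in> ?H" "x \<in> int_lattice"
      by (auto simp: lattice_points_def)
    have "f1 x \<in> \<int>" "f3 x \<in> \<int>"
      using x(2) functionals integer_functional_Ints by auto
    then have val: "f1 x = 0 \<or> f1 x = 1 \<or> f1 x = 2" "f3 x = 0 \<or> f3 x = 1 \<or> f3 x = 2"
      using bounds[OF x(1)] by (auto elim!: Ints_cases)
    consider "f1 x = 0" | "f1 x = 1" | "f1 x = 2"
      using val by blast
    then show "x \<in> S"
    proof cases
      case 1
      have "x = v2"
        by (rule hull_unique_max[OF affine(2) mem(2) _ x(1)]) (use f1 f2 1 S in auto)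
      then show ?thesis
        using mem by simp
    next
      case 2
      then have "x = p \<or> x = q \<or> x = v3"
        using val(2) inj f1 f3 by metis
      then show ?thesis
        using S by auto
    next
      case 3
      have "x = v1"
        by (rule hull_unique_max[OF affine(1) mem(1) _ x(1)]) (use f1 3 S in auto)
      then show ?thesis
        using mem by simp
    qed
  qed
  have "v1 \<notin> interior ?H"
    by (rule max_not_interior[OF affine(1), of v2]) (use f1 bounds in auto)
  moreover have "v2 \<notin> interior ?H"
    by (rule max_not_interior[OF affine(2), of v1]) (use f1 f2 bounds in auto)
  moreover have "v3 \<notin> interior ?H"
    by (rule max_not_interior[OF affine(3), of p]) (use f3 bounds in auto)
  moreover have "p \<notin> interior ?H"
  proof -
    have "affine_map (\<lambda>x. 0 - f3 x)"
      using functionals(3) by (intro integer_functional_affine integer_functional_diff_const) auto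
    then show ?thesis
      by (rule max_not_interior[of _ q]) (use f3 bounds in auto)
  qed
  moreover have "q \<in> interior ?H"
  proof (rule interior_if_not_supported)
    show "q \<in> ?H"
      using S by (auto intro: hull_inc)
    fix a assume a: "\<forall>y\<in>?H. a \<bullet> q \<le> a \<bullet> y"
    \<comment> \<open>A functional minimal at the midpoint \<open>q\<close> is constant along
      \<open>p\<close>, \<open>q\<close>, \<open>v3\<close>, hence up to a constant a multiple of
      \<open>f1\<close>. As \<open>v1\<close> and \<open>v2\<close> lie on different sides of this
      line, the multiple is 0.\<close>
    have "a \<bullet> p + a \<bullet> v3 = 2 * (a \<bullet> q)"
      using arg_cong[OF mid, of "\<lambda>x. a \<bullet> x"] by (simp add: inner_add_right)
    moreover have ge: "a \<bullet> q \<le> a \<bullet> y" if "y \<in> S" for y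
      using a that hull_inc by metis
    moreover have "p \<in> S"
      using S by simp
    ultimately have "a \<bullet> p = a \<bullet> q"
      using ge[of p] ge[OF mem(3)] by linarith
    moreover have "affine_map (\<lambda>x. a \<bullet> x)"
      by (simp add: affine_map_def linear_iff inner_add_right)
    moreover have "p \<noteq> q" "f1 p = f1 q" "f1 v1 \<noteq> f1 v2"
      using f1 f3 by auto
    ultimately obtain k where k: "\<forall>z. a \<bullet> z - a \<bullet> p = k * (f1 z - f1 p)"
      using affine_proportional[OF affine(1), of "\<lambda>x. a \<bullet> x" p q v1 v2] by metis
    have "k = 0"
      using k[rule_format, of v1] k[rule_format, of v2] ge[of v1] ge[of v2] mem f1 \<open>a \<bullet> p = a \<bullet> q\<close>
      by auto
    then have "a \<bullet> (p + a) = a \<bullet> p"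
      using k[rule_format, of "p + a"] by simp
    then show "a = 0"
      by (simp add: inner_add_right)
  qed simp
  moreover have "closed ?H"
    using finite by (simp add: compact_imp_closed finite_imp_compact_convex_hull)
  ultimately have "lattice_points (interior ?H) = {q}"
    "lattice_points (frontier ?H) = {v1, v2, v3, p}"
    using lat S interior_subset[of ?H] pq f3
    by (auto simp: lattice_points_def frontier_def)
  then show "card (lattice_points (frontier ?H)) = 4" "card (lattice_points (interior ?H)) = 1"
    using distinct pq by auto
qed

lemma opposite_case:
  assumes opp: "\<And>z. f1 z + f2 z = 2"
    and S: "S = {v1, v2, v3, p, q}" and pq: "p \<notin> {v1, v2, v3}" "q \<notin> {v1, v2, v3}" "p \<noteq> q"
    and lift: "liftable F S" "F p + F q \<ge> 4"
  shows "S = lattice_points (convex hull S) \<and>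
    card (lattice_points (frontier (convex hull S))) = 4 \<and>
    card (lattice_points (interior (convex hull S))) = 1"
proof -
  interpret s: three_separated S v1 v3 v2 f1 f3 f2
    by (rule swap23)
  have "f1 p = f1 q"
    using opposite_values(4)[OF opp] S pq by auto
  then have "f3 p \<noteq> f3 q"
    using s.parallel_opposite[OF pq(3)] not_opposite_13[OF opp] by blast
  then consider "f3 p = 0" "f3 q = 1" | "f3 q = 0" "f3 p = 1"
    using zero_one(3)[of p] zero_one(3)[of q] S pq by auto
  then show ?thesis
  proof cases
    case 1
    from opposite_height_two[OF opp S pq(1,2) 1 lift] opposite_polygon[OF opp S pq(1,2) 1]
    show ?thesis by simp
  next
    case 2
    have S': "S = {v1, v2, v3, q, p}" "F q + F p \<ge> 4"
      using S lift by auto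
    from opposite_height_two[OF opp S'(1) pq(2,1) 2 lift(1) S'(2)]
      opposite_polygon[OF opp S'(1) pq(2,1) 2]
    show ?thesis by simp
  qed
qed

end

subsection \<open>Five points\<close>

lemma zero_one_strict_combination:
  fixes a b x y z :: real
  assumes "a * x + b * y = z" "a > 0" "b > 0" "a + b = 1"
    and "x = 0 \<or> x = 1" "y = 0 \<or> y = 1" "z = 0 \<or> z = 1"
  shows "x = z" "y = z"
  using assms by auto

lemma zero_one_strict_combination3:
  fixes a b c x y z t :: real
  assumes "a * x + b * y + c * z = t" "a > 0" "b > 0" "c > 0" "a + b + c = 1"
    and "x = 0 \<or> x = 1" "y = 0 \<or> y = 1" "z = 0 \<or> z = 1" "t = 0 \<or> t = 1"
  shows "x = t" "y = t" "z = t"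
  using assms by auto

text \<open>Subtracting \<open>r = w / z\<close> times the coordinates of \<open>p\<close> from
  those of \<open>q\<close> removes \<open>c\<close>: what is left are nonnegative multiples of
  \<open>a\<close> and \<open>b\<close>. As coordinates sum to 1, \<open>1 - s - t = r\<close>, so
  \<open>s + t < 1\<close> amounts to \<open>w\<close> being positive.\<close>

lemma barycentric_cone_aux:
  fixes p q a b c :: "'a::real_vector"
  assumes "x > 0" "y > 0" "z > 0" "x + y + z = 1" "p = x *\<^sub>R a + y *\<^sub>R b + z *\<^sub>R c"
    and "u + v + w = 1" "q = u *\<^sub>R a + v *\<^sub>R b + w *\<^sub>R c"
    and "w / z \<le> u / x" "w / z \<le> v / y"
  shows "\<exists>s t. 0 \<le> s \<and> 0 \<le> t \<and> (0 < w \<longrightarrow> s + t < 1) \<and> q = p + s *\<^sub>R (a - p) + t *\<^sub>R (b - p)"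
proof -
  define r where "r = w / z"
  define s where "s = u - r * x"
  define t where "t = v - r * y"
  have "r * x \<le> u" "r * y \<le> v" and w: "r * z = w"
    using assms by (auto simp: r_def pos_le_divide_eq)
  then have "0 \<le> s" "0 \<le> t"
    by (auto simp: s_def t_def)
  moreover have st: "1 - s - t = r"
  proof -
    have "s + t = (u + v + w) - r * (x + y + z)"
      using w by (simp add: s_def t_def algebra_simps)
    then show ?thesis
      using assms by simp
  qed
  then have "s + t < 1" if "0 < w"
  proof -
    have "r > 0"
      using that assms(3) by (simp add: r_def)
    then show ?thesis
      using st by simp
  qed
  moreover have "q = p + s *\<^sub>R (a - p) + t *\<^sub>R (b - p)"
  proof -
    have "p + s *\<^sub>R (a - p) + t *\<^sub>R (b - p) = (1 - s - t) *\<^sub>R p + s *\<^sub>R a + t *\<^sub>R b"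
      by (simp add: algebra_simps)
    also have "\<dots> = (r * x + s) *\<^sub>R a + (r * y + t) *\<^sub>R b + (r * z) *\<^sub>R c"
      unfolding st by (simp add: assms(5) algebra_simps)
    also have "\<dots> = q"
      by (simp add: assms(7) w s_def t_def)
    finally show ?thesis by simp
  qed
  ultimately show ?thesis
    by blast
qed

text \<open>The cones at an inner point over the edges of a triangle cover the plane; the smallest
  of the three ratios of coordinates tells which of them contains \<open>q\<close>.\<close>

lemma barycentric_cone:
  fixes p q a b c :: "'a::real_vector"
  assumes "x > 0" "y > 0" "z > 0" "x + y + z = 1" "p = x *\<^sub>R a + y *\<^sub>R b + z *\<^sub>R c"
    and "u + v + w = 1" "q = u *\<^sub>R a + v *\<^sub>R b + w *\<^sub>R c"
  shows "\<exists>s t. 0 \<le> s \<and> 0 \<le> t \<and> (0 < u \<and> 0 < v \<and> 0 < w \<longrightarrow> s + t < 1) \<and>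
    (q = p + s *\<^sub>R (a - p) + t *\<^sub>R (b - p) \<or> q = p + s *\<^sub>R (b - p) + t *\<^sub>R (c - p) \<or>
     q = p + s *\<^sub>R (c - p) + t *\<^sub>R (a - p))"
proof -
  consider "w / z \<le> u / x" "w / z \<le> v / y" | "u / x \<le> v / y" "u / x \<le> w / z"
    | "v / y \<le> w / z" "v / y \<le> u / x"
    by linarith
  then show ?thesis
  proof cases
    case 1
    then show ?thesis
      using barycentric_cone_aux[OF assms] by blast
  next
    case 2
    have "y + z + x = 1" "p = y *\<^sub>R b + z *\<^sub>R c + x *\<^sub>R a" "v + w + u = 1"
      "q = v *\<^sub>R b + w *\<^sub>R c + u *\<^sub>R a"
      using assms by (auto simp: add_ac)
    from barycentric_cone_aux[OF assms(2,3,1) this 2] show ?thesis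
      by blast
  next
    case 3
    have "z + x + y = 1" "p = z *\<^sub>R c + x *\<^sub>R a + y *\<^sub>R b" "w + u + v = 1"
      "q = w *\<^sub>R c + u *\<^sub>R a + v *\<^sub>R b"
      using assms by (auto simp: add_ac)
    from barycentric_cone_aux[OF assms(3,1,2) this 3] show ?thesis
      by blast
  qed
qed

lemma not_collinear_barycentric:
  fixes a b c q :: "real^2"
  assumes "\<not> collinear {a, b, c}"
  obtains u v w where "u + v + w = 1" "q = u *\<^sub>R a + v *\<^sub>R b + w *\<^sub>R c"
proof -
  have "aff_dim {a, b, c} = int DIM(real^2)"
    using triangle_simplex(1)[OF assms] by (simp add: aff_dim_convex_hull)
  then have "q \<in> affine hull {a, b, c}"
    using aff_dim_eq_full by blast
  then show ?thesis
    using that by (auto simp: affine_hull_3)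
qed

section \<open>Position of the remaining points relative to the separated ones\<close>

context three_separated begin

lemma v3_not_between: "v3 \<notin> closed_segment v1 v2"
proof
  assume "v3 \<in> closed_segment v1 v2"
  then have "v3 \<in> convex hull {v1, v2}"
    by (simp add: segment_convex_hull)
  moreover have "f3 y \<le> 1" if "y \<in> {v1, v2}" for y
    using that zero_one(3)[of v1] zero_one(3)[of v2] mem distinct by auto
  ultimately have "f3 v3 \<le> 1"
    by (rule affine_map_le_hull[OF affine(3)])
  then show False
    using large by simp
qed

lemma not_collinear: "\<not> collinear {v1, v2, v3}"
proof -
  interpret r: three_separated S v2 v3 v1 f2 f3 f1
    by (rule rotate)
  interpret rr: three_separated S v3 v1 v2 f3 f1 f2
    by (rule r.rotate)
  show ?thesis
    using v3_not_between r.v3_not_between rr.v3_not_between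
    by (auto simp: collinear_between_cases between_mem_segment)
qed

text \<open>Positivity forces \<open>f1 p = f2 p = 1\<close>, while the values at \<open>v1\<close>
  and \<open>v2\<close> contribute at least \<open>2 * a\<close> and \<open>2 * b\<close>. So
  neither \<open>a\<close> nor \<open>b\<close> exceeds 1/2, and equality holds throughout.\<close>

lemma edge_midpoint:
  assumes "p \<in> S" "p \<notin> {v1, v2, v3}" "p = a *\<^sub>R v1 + b *\<^sub>R v2" "a > 0" "b > 0" "a + b = 1"
  shows "f1 v1 = 2" "f1 v2 = 0" "f1 p = 1" "f2 v2 = 2" "f2 v1 = 0" "f2 p = 1" "v1 + v2 = 2 *\<^sub>R p"
    "f3 v1 = f3 p" "f3 v2 = f3 p"
proof -
  have f: "f p = a * f v1 + b * f v2" if "affine_map f" for f :: "real^2 \<Rightarrow> real"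
    using affine_map_combination2[OF that assms(6)] assms(3) by simp
  have f1: "f1 v2 = 0 \<or> f1 v2 = 1" "f1 p = 0 \<or> f1 p = 1"
    and f2: "f2 v1 = 0 \<or> f2 v1 = 1" "f2 p = 0 \<or> f2 p = 1"
    and f3: "f3 v1 = 0 \<or> f3 v1 = 1" "f3 v2 = 0 \<or> f3 v2 = 1" "f3 p = 0 \<or> f3 p = 1"
    using zero_one mem distinct assms(1,2) by auto
  define x where "x = a * f1 v1"
  define y where "y = b * f2 v2"
  have am: "x \<ge> a * 2" and bm: "y \<ge> b * 2"
    using large assms(4,5) by (auto simp: x_def y_def intro: mult_left_mono)
  have 1: "f1 p = 1" "f1 v2 = 0" "x = 1"
    using f[OF affine(1), folded x_def] f1 am assms(4-6) by auto
  have 2: "f2 p = 1" "f2 v1 = 0" "y = 1"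
    using f[OF affine(2), folded y_def] f2 bm assms(4-6) by auto
  have ab: "a = 1/2" "b = 1/2"
    using 1(3) 2(3) am bm assms(6) by auto
  then show "f1 v1 = 2" "f1 v2 = 0" "f1 p = 1" "f2 v2 = 2" "f2 v1 = 0" "f2 p = 1"
    using 1 2 unfolding x_def y_def ab by auto
  show "v1 + v2 = 2 *\<^sub>R p"
    using assms(3) ab by (simp add: algebra_simps)
  show "f3 v1 = f3 p" "f3 v2 = f3 p"
    using zero_one_strict_combination[OF f[OF affine(3), symmetric] assms(4-6) f3] by auto
qed

text \<open>The functional \<open>g = 2 - f1 - f2\<close> vanishes on the edge. It is 1 or 2 at
  \<open>q\<close> and \<open>v3\<close>, since 0 would give them the coordinates of
  \<open>p\<close>. As a multiple of \<open>f3 - f3 v1\<close>, it is at least twice as large at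
  \<open>v3\<close> as at \<open>q\<close>. So the values are 2 and 1, and \<open>q\<close> is the
  midpoint of another edge.\<close>

lemma five_points_edge:
  assumes S: "S = {v1, v2, v3, p, q}" and pq: "p \<notin> {v1, v2, v3}" "q \<notin> {v1, v2, v3}" "p \<noteq> q"
    and p: "p = a *\<^sub>R v1 + b *\<^sub>R v2" "a > 0" "b > 0" "a + b = 1"
    and not_opp: "\<not> (\<forall>z. f1 z + f2 z = 2)"
  shows "\<exists>T. unimodular_triangle T \<and> second_dilation_of (convex hull S) T"
proof -
  have inj: "x = y" if "f1 x = f1 y" "f2 x = f2 y" for x y
    using that parallel_opposite not_opp by blast
  have in_S: "p \<in> S" "q \<in> S"
    using S by auto
  note mid = edge_midpoint[OF in_S(1) pq(1) p]
  define g where "g z = 2 - f1 z - f2 z" for z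
  have "integer_functional g"
    using integer_functional_diff[OF integer_functional_diff_const(2)[OF functionals(1), of 2] functionals(2)]
    by (simp add: g_def[abs_def])
  then have "affine_map g"
    by (rule integer_functional_affine)
  have g: "g v1 = 0" "g v2 = 0" "g p = 0"
    using mid by (auto simp: g_def)
  have "f3 v1 = f3 v2" "f3 v3 \<noteq> f3 v1"
    using mid large zero_one(3) mem distinct by fastforce+
  then obtain k where k: "\<forall>z. g z - g v1 = k * (f3 z - f3 v1)"
    using affine_proportional[OF affine(3) \<open>affine_map g\<close> distinct(1), of v3 v1] g by metis
  have val: "f1 q = 0 \<or> f1 q = 1" "f2 q = 0 \<or> f2 q = 1" "f3 q = 0 \<or> f3 q = 1"
    "f1 v3 = 0 \<or> f1 v3 = 1" "f2 v3 = 0 \<or> f2 v3 = 1" "f3 v1 = 0 \<or> f3 v1 = 1"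
    using zero_one mem distinct in_S pq by auto
  have "g q \<noteq> 0" "g v3 \<noteq> 0"
    using inj[of q p] inj[of v3 p] mid pq val by (auto simp: g_def)
  then have gq: "g q = 1 \<or> g q = 2" "g v3 = 1 \<or> g v3 = 2"
    using val by (auto simp: g_def)
  have kq: "g q = k * (f3 q - f3 v1)" and kv: "g v3 = k * (f3 v3 - f3 v1)"
    using k g by auto
  have "f3 v3 - f3 v1 > 0"
    using large val by auto
  moreover have "k * (f3 v3 - f3 v1) > 0"
    unfolding kv[symmetric] using gq by auto
  ultimately have "k > 0"
    by (simp add: zero_less_mult_iff)
  moreover have "k * (f3 q - f3 v1) > 0"
    unfolding kq[symmetric] using gq by auto
  ultimately have "f3 q - f3 v1 > 0"
    by (simp add: zero_less_mult_iff)
  then have q3: "f3 q = 1" "f3 v1 = 0"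
    using val by auto
  then have "g v3 = g q * f3 v3"
    unfolding kq kv by simp
  moreover have "g q * f3 v3 \<ge> g q * 2"
    by (rule mult_left_mono) (use large gq in auto)
  ultimately have "g v3 \<ge> g q * 2"
    by simp
  then have "g q = 1" "g v3 = 2"
    using gq by auto
  then have v3: "f1 v3 = 0" "f2 v3 = 0" and q: "(f1 q = 1 \<and> f2 q = 0) \<or> (f1 q = 0 \<and> f2 q = 1)"
    using val by (auto simp: g_def)
  have "2 *\<^sub>R q = v1 + v3 \<or> 2 *\<^sub>R q = v2 + v3"
  proof -
    have f: "f ((1/2) *\<^sub>R x + (1/2) *\<^sub>R y) = f x / 2 + f y / 2" if "affine_map f"
      for f :: "real^2 \<Rightarrow> real" and x y
      using affine_map_combination2[OF that, of "1/2" "1/2"] by simp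
    have "q = (1/2) *\<^sub>R v1 + (1/2) *\<^sub>R v3 \<or> q = (1/2) *\<^sub>R v2 + (1/2) *\<^sub>R v3"
      using q by (elim disjE; intro disjI1 inj disjI2) (auto simp: f affine mid v3)
    then show ?thesis
      by (auto simp: scaleR_add_right)
  qed
  then have "q \<in> convex hull {v1, v2, v3}"
    by (auto intro: midpoint_in_hull hull_inc)
  moreover have "p \<in> convex hull {v1, v2, v3}"
    using mid(7) by (auto intro: midpoint_in_hull[of p v1 v2] hull_inc)
  ultimately have "S \<subseteq> convex hull {v1, v2, v3}"
    unfolding S by (auto intro: hull_inc)
  then show ?thesis
    using second_dilation_midpoint[OF lattice wide _ mem in_S(1) mid(7) functionals(1) _ _ _ functionals(2)]
      mid v3 by simp
qed

text \<open>\<open>f2\<close> and \<open>f3\<close> are 0 or 1 at \<open>v1\<close>, at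
  \<open>q\<close> and at \<open>p\<close> strictly between them, hence constant there; so
  \<open>(f2, f3)\<close> does not tell \<open>p\<close> from \<open>q\<close>.\<close>

lemma five_points_ray:
  assumes "p \<in> S" "q \<in> S" "p \<notin> {v1, v2, v3}" "q \<notin> {v1, v2, v3}" "p \<noteq> q"
    and "p = a *\<^sub>R v1 + b *\<^sub>R q" "a > 0" "b > 0" "a + b = 1"
  shows "\<forall>z. f2 z + f3 z = 2"
proof -
  interpret r: three_separated S v2 v3 v1 f2 f3 f1
    by (rule rotate)
  have f: "a * f v1 + b * f q = f p" if "affine_map f" for f :: "real^2 \<Rightarrow> real"
    using affine_map_combination2[OF that assms(9)] assms(6) by simp
  have "f2 p = f2 q" "f3 p = f3 q"
    using zero_one_strict_combination[OF f[OF affine(2)] assms(7-9)]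
      zero_one_strict_combination[OF f[OF affine(3)] assms(7-9)] zero_one mem distinct assms(1-4)
    by (metis insertCI)+
  then show ?thesis
    using r.parallel_opposite[OF assms(5)] by blast
qed

text \<open>With values 0 and 1 at the corners and at the inner point \<open>p\<close>,
  \<open>f3\<close> is constant on them. As \<open>f1\<close> has only two values for
  \<open>v2\<close>, \<open>q\<close>, \<open>p\<close>, two of these agree under
  \<open>(f3, f1)\<close>.\<close>

lemma five_points_flat:
  assumes "p \<in> S" "q \<in> S" "p \<notin> {v1, v2, v3}" "q \<notin> {v1, v2, v3}" "p \<noteq> q"
    and "p = a *\<^sub>R v1 + b *\<^sub>R v2 + c *\<^sub>R q" "a > 0" "b > 0" "c > 0" "a + b + c = 1"
  shows "\<forall>z. f3 z + f1 z = 2"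
proof -
  interpret rr: three_separated S v3 v1 v2 f3 f1 f2
    using rotate by (rule three_separated.rotate)
  have f: "a * f v1 + b * f v2 + c * f q = f p" if "affine_map f" for f :: "real^2 \<Rightarrow> real"
    using affine_map_combination[OF that assms(10)] assms(6) by simp
  have v: "f3 v1 = 0 \<or> f3 v1 = 1" "f3 v2 = 0 \<or> f3 v2 = 1" "f3 q = 0 \<or> f3 q = 1" "f3 p = 0 \<or> f3 p = 1"
    and v': "f1 v2 = 0 \<or> f1 v2 = 1" "f1 q = 0 \<or> f1 q = 1" "f1 p = 0 \<or> f1 p = 1"
    using zero_one mem distinct assms(1-4) by auto
  have "f3 v2 = f3 p" "f3 q = f3 p"
    using zero_one_strict_combination3[OF f[OF affine(3)] assms(7-10) v] by auto
  moreover have "f1 v2 = f1 q \<or> f1 v2 = f1 p \<or> f1 q = f1 p"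
    using v' by auto
  moreover have "v2 \<noteq> q" "v2 \<noteq> p" "q \<noteq> p"
    using assms by auto
  ultimately show ?thesis
    using rr.parallel_opposite by metis
qed

lemma inner_point_values:
  assumes "p \<in> S" "p \<notin> {v1, v2, v3}"
    and "p = a *\<^sub>R v1 + b *\<^sub>R v2 + c *\<^sub>R v3" "a > 0" "b > 0" "c > 0" "a + b + c = 1"
  shows "f1 p = 1"
proof -
  have "f1 p = a * f1 v1 + b * f1 v2 + c * f1 v3"
    using affine_map_combination[OF affine(1) assms(7)] assms(3) by simp
  moreover have "a * f1 v1 > 0" "b * f1 v2 \<ge> 0" "c * f1 v3 \<ge> 0"
    using large assms(4-6) zero_one(1)[of v2] zero_one(1)[of v3] mem distinct by auto
  ultimately show ?thesis
    using zero_one(1)[of p] assms(1,2) by auto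
qed

text \<open>The lower bounds \<open>1 + s - t\<close> for \<open>f1 q\<close> and
  \<open>1 + t - s\<close> for \<open>f2 q\<close> add up to 2, and neither value exceeds 1. So
  \<open>q\<close> has the same values as \<open>p\<close>.\<close>

lemma five_points_cone:
  assumes "q \<in> S" "q \<notin> {v1, v2, v3}" "p \<noteq> q" "f1 p = 1" "f2 p = 1"
    and q: "q = p + s *\<^sub>R (v1 - p) + t *\<^sub>R (v2 - p)" "s \<ge> 0" "t \<ge> 0"
  shows "\<forall>z. f1 z + f2 z = 2"
proof -
  have f: "f q = f p + s * (f v1 - f p) + t * (f v2 - f p)" if "affine_map f" for f :: "real^2 \<Rightarrow> real"
  proof -
    have q': "q = (1 - s - t) *\<^sub>R p + s *\<^sub>R v1 + t *\<^sub>R v2"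
      using q(1) by (simp add: algebra_simps)
    have "f ((1 - s - t) *\<^sub>R p + s *\<^sub>R v1 + t *\<^sub>R v2) = (1 - s - t) * f p + s * f v1 + t * f v2"
      using affine_map_combination[OF that, of "1 - s - t" s t p v1 v2] by simp
    then have "f q = (1 - s - t) * f p + s * f v1 + t * f v2"
      by (simp only: q')
    then show ?thesis
      by (simp add: algebra_simps)
  qed
  have v: "f1 v2 = 0 \<or> f1 v2 = 1" "f1 q = 0 \<or> f1 q = 1" "f2 v1 = 0 \<or> f2 v1 = 1" "f2 q = 0 \<or> f2 q = 1"
    using zero_one mem distinct assms(1,2) by auto
  have "s * (f1 v1 - 1) \<ge> s * 1" "t * (f1 v2 - 1) \<ge> t * (-1)"
    "t * (f2 v2 - 1) \<ge> t * 1" "s * (f2 v1 - 1) \<ge> s * (-1)"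
    by (intro mult_left_mono; use v large q(2,3) in auto)+
  then have "f1 q \<ge> 1 + s - t" "f2 q \<ge> 1 + t - s"
    using f[OF affine(1)] f[OF affine(2)] assms(4,5) by auto
  then have "f1 q = 1" "f2 q = 1"
    using v by auto
  then show ?thesis
    using parallel_opposite[OF assms(3)] assms(4,5) by auto
qed

lemma five_points_vertex_triangle:
  assumes S: "S = {v1, v2, v3, p, q}" and pq: "p \<notin> {v1, v2, v3}" "q \<notin> {v1, v2, v3}" "p \<noteq> q"
    and p: "p \<in> convex hull {v1, v2, v3}"
    and not_opp: "\<not> (\<forall>z. f1 z + f2 z = 2)" "\<not> (\<forall>z. f2 z + f3 z = 2)" "\<not> (\<forall>z. f3 z + f1 z = 2)"
  shows "\<exists>T. unimodular_triangle T \<and> second_dilation_of (convex hull S) T"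
proof -
  interpret r: three_separated S v2 v3 v1 f2 f3 f1
    by (rule rotate)
  interpret rr: three_separated S v3 v1 v2 f3 f1 f2
    by (rule r.rotate)
  obtain a b c where abc: "p = a *\<^sub>R v1 + b *\<^sub>R v2 + c *\<^sub>R v3" "0 \<le> a" "0 \<le> b" "0 \<le> c" "a + b + c = 1"
    using p by (auto simp: convex_hull_3)
  have S': "S = {v2, v3, v1, p, q}" "S = {v3, v1, v2, p, q}"
    using S by auto
  have pq': "p \<notin> {v2, v3, v1}" "q \<notin> {v2, v3, v1}" "p \<notin> {v3, v1, v2}" "q \<notin> {v3, v1, v2}"
    using pq by auto
  have in_S: "p \<in> S" "q \<in> S"
    using S by auto
  \<comment> \<open>An inner \<open>p\<close> has value 1 under all three functionals, so the cone
    at \<open>p\<close> containing \<open>q\<close> would make two of them opposite. Hence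
    \<open>p\<close> lies on an edge.\<close>
  have "\<not> (a > 0 \<and> b > 0 \<and> c > 0)"
  proof
    assume pos: "a > 0 \<and> b > 0 \<and> c > 0"
    have abc': "b + c + a = 1" "p = b *\<^sub>R v2 + c *\<^sub>R v3 + a *\<^sub>R v1"
      "c + a + b = 1" "p = c *\<^sub>R v3 + a *\<^sub>R v1 + b *\<^sub>R v2"
      using abc by (auto simp: add_ac)
    have fp: "f1 p = 1" "f2 p = 1" "f3 p = 1"
      using inner_point_values[OF in_S(1) pq(1) abc(1)] r.inner_point_values[OF in_S(1) pq'(1) abc'(2)]
        rr.inner_point_values[OF in_S(1) pq'(3) abc'(4)] pos abc(5) abc'(1,3) by auto
    obtain u v w where uvw: "u + v + w = 1" "q = u *\<^sub>R v1 + v *\<^sub>R v2 + w *\<^sub>R v3"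
      using not_collinear_barycentric[OF not_collinear] by blast
    obtain s t where st: "0 \<le> s" "0 \<le> t" and
      "q = p + s *\<^sub>R (v1 - p) + t *\<^sub>R (v2 - p) \<or> q = p + s *\<^sub>R (v2 - p) + t *\<^sub>R (v3 - p) \<or>
       q = p + s *\<^sub>R (v3 - p) + t *\<^sub>R (v1 - p)"
      using barycentric_cone[OF _ _ _ abc(5,1) uvw] pos by blast
    then show False
      using five_points_cone[OF in_S(2) pq(2,3) fp(1,2) _ st] r.five_points_cone[OF in_S(2) pq'(2) pq(3) fp(2,3) _ st]
        rr.five_points_cone[OF in_S(2) pq'(4) pq(3) fp(3,1) _ st] not_opp by blast
  qed
  then consider "a = 0" | "b = 0" | "c = 0"
    using abc by linarith
  then show ?thesis
  proof cases
    case 1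
    then have "b \<noteq> 0" "c \<noteq> 0"
      using abc pq by auto
    then show ?thesis
      using r.five_points_edge[OF S'(1) pq'(1,2) pq(3), of b c] abc 1 not_opp by auto
  next
    case 2
    then have "a \<noteq> 0" "c \<noteq> 0"
      using abc pq by auto
    then show ?thesis
      using rr.five_points_edge[OF S'(2) pq'(3,4) pq(3), of c a] abc 2 not_opp by (auto simp: add_ac)
  next
    case 3
    then have "a \<noteq> 0" "b \<noteq> 0"
      using abc pq by auto
    then show ?thesis
      using five_points_edge[OF S pq, of a b] abc 3 not_opp by auto
  qed
qed

lemma five_points_mixed_triangle:
  assumes S: "S = {v1, v2, v3, p, q}" and pq: "p \<notin> {v1, v2, v3}" "q \<notin> {v1, v2, v3}" "p \<noteq> q"
    and p: "p \<in> convex hull {v1, v2, q}"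
    and not_opp: "\<not> (\<forall>z. f1 z + f2 z = 2)" "\<not> (\<forall>z. f2 z + f3 z = 2)" "\<not> (\<forall>z. f3 z + f1 z = 2)"
  shows "\<exists>T. unimodular_triangle T \<and> second_dilation_of (convex hull S) T"
proof -
  interpret r: three_separated S v2 v3 v1 f2 f3 f1
    by (rule rotate)
  obtain a b c where abc: "p = a *\<^sub>R v1 + b *\<^sub>R v2 + c *\<^sub>R q" "0 \<le> a" "0 \<le> b" "0 \<le> c" "a + b + c = 1"
    using p by (auto simp: convex_hull_3)
  have pq': "p \<notin> {v2, v3, v1}" "q \<notin> {v2, v3, v1}"
    using pq by auto
  have in_S: "p \<in> S" "q \<in> S"
    using S by auto
  have "\<not> (a > 0 \<and> b > 0 \<and> c > 0)"
    using five_points_flat[OF in_S pq abc(1) _ _ _ abc(5)] not_opp by blast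
  then consider "a = 0" | "b = 0" | "c = 0"
    using abc by linarith
  then show ?thesis
  proof cases
    case 1
    then have "b \<noteq> 0" "c \<noteq> 0"
      using abc pq by auto
    then show ?thesis
      using r.five_points_ray[OF in_S pq' pq(3), of b c] abc 1 not_opp by auto
  next
    case 2
    then have "a \<noteq> 0" "c \<noteq> 0"
      using abc pq by auto
    then show ?thesis
      using five_points_ray[OF in_S pq, of a c] abc 2 not_opp by auto
  next
    case 3
    then have "a \<noteq> 0" "b \<noteq> 0"
      using abc pq by auto
    then show ?thesis
      using five_points_edge[OF S pq, of a b] abc 3 not_opp by auto
  qed
qed

text \<open>Caratheodory's theorem puts \<open>p\<close> into the hull of three of the other four
  points: the separated points, or \<open>q\<close> and two of them. Lifting enters only through the
  case of opposite functionals.\<close>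

lemma five_points:
  assumes S: "S = {v1, v2, v3, p, q}" and pq: "p \<notin> {v1, v2, v3}" "q \<notin> {v1, v2, v3}" "p \<noteq> q"
    and p: "p \<in> convex hull (S - {p})"
    and lift: "liftable F S" "F p + F q \<ge> 4"
  shows "(\<exists>T. unimodular_triangle T \<and> second_dilation_of (convex hull S) T) \<or>
    S = lattice_points (convex hull S) \<and>
    card (lattice_points (frontier (convex hull S))) = 4 \<and>
    card (lattice_points (interior (convex hull S))) = 1"
proof -
  interpret r: three_separated S v2 v3 v1 f2 f3 f1
    by (rule rotate)
  interpret rr: three_separated S v3 v1 v2 f3 f1 f2
    by (rule r.rotate)
  have S': "S = {v2, v3, v1, p, q}" "S = {v3, v1, v2, p, q}"
    using S by auto
  have pq': "p \<notin> {v2, v3, v1}" "q \<notin> {v2, v3, v1}" "p \<notin> {v3, v1, v2}" "q \<notin> {v3, v1, v2}"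
    using pq by auto
  show ?thesis
  proof (cases "(\<forall>z. f1 z + f2 z = 2) \<or> (\<forall>z. f2 z + f3 z = 2) \<or> (\<forall>z. f3 z + f1 z = 2)")
    case True
    then show ?thesis
      using opposite_case[OF _ S pq lift] r.opposite_case[OF _ S'(1) pq'(1,2) pq(3) lift]
        rr.opposite_case[OF _ S'(2) pq'(3,4) pq(3) lift] by blast
  next
    case False
    have "S - {p} = {v1, v2, v3, q}"
      using S pq by auto
    then obtain U where U: "finite U" "U \<subseteq> {v1, v2, v3, q}" "card U \<le> 3" "p \<in> convex hull U"
      using p caratheodory[of "S - {p}"] by auto
    have "\<not> {v1, v2, v3, q} \<subseteq> U"
    proof
      assume "{v1, v2, v3, q} \<subseteq> U"
      then have "card {v1, v2, v3, q} \<le> card U"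
        using U(1) by (rule card_mono[rotated])
      then show False
        using U(3) pq distinct by auto
    qed
    then have "U \<subseteq> {v1, v2, v3} \<or> U \<subseteq> {v1, v2, q} \<or> U \<subseteq> {v2, v3, q} \<or> U \<subseteq> {v3, v1, q}"
      using U(2) by blast
    then have "p \<in> convex hull {v1, v2, v3} \<or> p \<in> convex hull {v1, v2, q} \<or>
      p \<in> convex hull {v2, v3, q} \<or> p \<in> convex hull {v3, v1, q}"
      using U(4) hull_mono by blast
    then show ?thesis
      using five_points_vertex_triangle[OF S pq] five_points_mixed_triangle[OF S pq]
        r.five_points_mixed_triangle[OF S'(1) pq'(1,2) pq(3)]
        rr.five_points_mixed_triangle[OF S'(2) pq'(3,4) pq(3)] False by blast
  qed
qed

end

subsection \<open>Four points\<close>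

text \<open>By Bezout, \<open>t\<close> times the gcd of the coordinates of a nonzero
  \<open>d\<close> is an integer. It lies strictly between 0 and the gcd, which is thus at least 2
  and can be divided out.\<close>

lemma lattice_vector_divisible:
  fixes d :: "real^2"
  assumes "d \<in> int_lattice" "t *\<^sub>R d \<in> int_lattice" "0 < t" "t < 1"
  obtains m w where "m \<ge> 2" "w \<in> int_lattice" "d = real m *\<^sub>R w"
proof -
  obtain a b where ab: "d $ 1 = of_int a" "d $ 2 = of_int b"
    using assms(1) by (auto simp: int_lattice_2 elim!: Ints_cases)
  show ?thesis
  proof (cases "gcd a b = 0")
    case True
    then have "d = real 2 *\<^sub>R d"
      using ab by (simp add: vec_eq_iff forall_2)
    then show ?thesis
      using that[of 2 d] assms(1) by simp
  next
    case False
    define g where "g = gcd a b"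
    have g: "g > 0"
      using False by (simp add: g_def)
    obtain x y where "x * a + y * b = g"
      using bezout_int[of a b] by (auto simp: g_def)
    then have "real_of_int g = of_int (x * a + y * b)"
      by simp
    then have "t * of_int g = of_int x * (t * d $ 1) + of_int y * (t * d $ 2)"
      by (simp add: ab algebra_simps)
    moreover have "t * d $ 1 \<in> \<int>" "t * d $ 2 \<in> \<int>"
      using assms(2) by (auto simp: int_lattice_2)
    ultimately have "t * of_int g \<in> \<int>"
      by auto
    then obtain k where k: "t * of_int g = of_int k"
      by (elim Ints_cases)
    have "0 < t * of_int g" "t * of_int g < 1 * of_int g"
      using g assms(3,4) by (simp_all only: mult_pos_pos of_int_0_less_iff mult_less_cancel_right_pos)
    then have "g \<ge> 2"
      unfolding k by simp
    define w where "w = (vector [of_int (a div g), of_int (b div g)] :: real^2)"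
    have "d = real (nat g) *\<^sub>R w"
      using g ab by (simp add: w_def vec_eq_iff forall_2 g_def flip: of_int_mult)
    moreover have "w \<in> int_lattice"
      by (simp add: w_def int_lattice_2)
    ultimately show ?thesis
      using that[of "nat g" w] \<open>g \<ge> 2\<close> by simp
  qed
qed

context three_separated begin

text \<open>\<open>g v3\<close> is 0, 1 or 2, and 2 gives the second dilation. The value 1 would
  make \<open>g\<close> a functional of extent 1. The value 0 puts \<open>v3\<close> on the line
  \<open>f1 = 1\<close> through \<open>p\<close>; wideness places it at least two lattice steps from
  \<open>p\<close>, and lifting fills the first step with a point that \<open>S\<close> does not
  have.\<close>

lemma four_points_edge:
  assumes S: "S = {v1, v2, v3, p}" and p: "p \<notin> {v1, v2, v3}" "p = a *\<^sub>R v1 + b *\<^sub>R v2" "a > 0" "b > 0" "a + b = 1"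
    and lift: "liftable F S" "F p \<ge> 2"
  shows "\<exists>T. unimodular_triangle T \<and> second_dilation_of (convex hull S) T"
proof -
  have in_S: "p \<in> S"
    using S by auto
  note mid = edge_midpoint[OF in_S p]
  define g where "g z = 2 - f1 z - f2 z" for z
  have g_int: "integer_functional g"
    using integer_functional_diff[OF integer_functional_diff_const(2)[OF functionals(1), of 2] functionals(2)]
    by (simp add: g_def[abs_def])
  have g: "g v1 = 0" "g v2 = 0" "g p = 0"
    using mid by (auto simp: g_def)
  have val: "f1 v3 = 0 \<or> f1 v3 = 1" "f2 v3 = 0 \<or> f2 v3 = 1"
    using zero_one mem distinct by auto
  have "g v3 \<noteq> 1"
  proof
    assume g3: "g v3 = 1"
    then have "g v3 \<noteq> g v1"
      using g by simp
    from wide_extent[OF wide g_int this] obtain x y where "x \<in> S" "y \<in> S" "g y - g x > 1" .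
    then show False
      using g g3 unfolding S by auto
  qed
  moreover have "g v3 \<noteq> 0"
  proof
    assume "g v3 = 0"
    then have f1v3: "f1 v3 = 1"
      using val by (auto simp: g_def)
    obtain s t c where f1: "f1 = (\<lambda>x. s * x $ 1 + t * x $ 2 + c)" "s \<in> \<int>" "t \<in> \<int>"
      using integer_functional_2E[OF functionals(1)] by blast
    define u where "u = v1 - p"
    define d where "d = v3 - p"
    \<comment> \<open>The direction of the level lines of \<open>f1\<close>. Since
      \<open>f1 v1 - f1 p = 1\<close>, the determinant of \<open>u\<close> and \<open>w\<close> is
      1, so \<open>cross2 u d\<close> is the coordinate of \<open>d\<close> along
      \<open>w\<close>.\<close>
    define w where "w = (vector [- t, s] :: real^2)"
    define n where "n = cross2 u d"
    have su: "s * u $ 1 + t * u $ 2 = 1" and sd: "s * d $ 1 + t * d $ 2 = 0"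
      using mid f1v3 by (auto simp: f1 u_def d_def algebra_simps)
    have "d = n *\<^sub>R w"
    proof -
      have "n * (- t) = (s * u $ 1 + t * u $ 2) * d $ 1 - u $ 1 * (s * d $ 1 + t * d $ 2)"
        "n * s = (s * u $ 1 + t * u $ 2) * d $ 2 - u $ 2 * (s * d $ 1 + t * d $ 2)"
        by (simp_all add: n_def cross2_def algebra_simps)
      then show ?thesis
        by (simp add: su sd w_def vec_eq_iff forall_2)
    qed
    have lat: "u \<in> int_lattice" "d \<in> int_lattice" "p \<in> int_lattice" "w \<in> int_lattice"
      using lattice mem in_S f1(2,3) unfolding u_def d_def
      by (auto simp: w_def int_lattice_2[of "vector [- t, s]"] intro!: int_lattice_diff)
    have "d \<noteq> 0"
      using p by (auto simp: d_def)
    then have "n \<noteq> 0" "w \<noteq> 0"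
      using \<open>d = n *\<^sub>R w\<close> by auto
    define h where "h x = cross2 u (x - p)" for x
    have h_int: "integer_functional h"
      unfolding h_def using lat by (intro integer_functional_cross2)
    have "v2 - p = (-1) *\<^sub>R u"
      using mid(7) by (simp add: u_def algebra_simps scaleR_2)
    then have h: "h v1 = 0" "h v2 = 0" "h p = 0" "h v3 = n"
      using cross2_parallel[of 1 u "-1"] cross2_parallel[of 1 u 1]
      by (auto simp: h_def n_def cross2_def simp flip: u_def d_def)
    have "h v3 \<noteq> h v1"
      using h \<open>n \<noteq> 0\<close> by simp
    from wide_extent[OF wide h_int this] obtain x y where "x \<in> S" "y \<in> S" "h y - h x > 1" .
    then have "\<bar>n\<bar> > 1"
      using h unfolding S by auto
    moreover have "n \<in> \<int>"
      using h(4) mem lattice integer_functional_Ints[OF h_int] by auto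
    ultimately obtain k where k: "n = of_int k" "\<bar>k\<bar> > 1"
      by (auto elim!: Ints_cases simp flip: of_int_abs)
    define m where "m = nat \<bar>k\<bar>"
    \<comment> \<open>The sign goes into the direction, as lifting counts steps by a natural
      number.\<close>
    define w' where "w' = of_int (sgn k) *\<^sub>R w"
    have m: "m \<ge> 2"
      using k by (simp add: m_def)
    have "w' \<in> int_lattice"
      unfolding w'_def using lat(4) by (intro int_lattice_scaleR) auto
    moreover have "w' \<noteq> 0"
      using \<open>w \<noteq> 0\<close> k by (auto simp: w'_def sgn_if)
    ultimately have w': "w' \<in> int_lattice" "w' \<noteq> 0" .
    have "real m * of_int (sgn k) = n"
      using k by (auto simp: m_def sgn_if)
    then have v3: "v3 = p + real m *\<^sub>R w'"
      using \<open>d = n *\<^sub>R w\<close> by (simp add: w'_def d_def algebra_simps)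
    have "p + real m *\<^sub>R w' \<in> S"
      using mem(3) unfolding v3 .
    then have "p + real 1 *\<^sub>R w' \<in> S"
      using lift(2) m by (intro liftableD[OF lift(1) _ lat(3) w'(1), of 1 m 1]) linarith+
    then have in_S': "p + w' \<in> S"
      by simp
    have "f1 (p + w') = 1"
      using mid by (simp add: f1 w'_def w_def algebra_simps)
    then have "p + w' = p \<or> p + w' = v3"
      using in_S' mid unfolding S by auto
    then have "w' = real m *\<^sub>R w'"
      using w' unfolding v3 by simp
    then have "(real m - 1) *\<^sub>R w' = 0"
      by (simp add: algebra_simps)
    then show False
      using m w' by simp
  qed
  ultimately have v3: "f1 v3 = 0" "f2 v3 = 0"
    using val by (auto simp: g_def)
  have "p \<in> convex hull {v1, v2, v3}"
    using mid(7) by (auto intro: midpoint_in_hull[of p v1 v2] hull_inc)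
  then have "S \<subseteq> convex hull {v1, v2, v3}"
    unfolding S by (auto intro: hull_inc)
  then show ?thesis
    using second_dilation_midpoint[OF lattice wide _ mem in_S mid(7) functionals(1) _ _ _ functionals(2)]
      mid v3 by simp
qed

text \<open>A lattice point strictly between \<open>p\<close> and \<open>v1\<close> makes
  \<open>v1 - p\<close> divisible, and two points over \<open>p\<close> suffice to lift a point of
  \<open>S\<close> in between. On this segment \<open>f2\<close> and \<open>f3\<close> are at most
  1, so that point is neither \<open>v2\<close> nor \<open>v3\<close>.\<close>

lemma four_points_ray:
  assumes S: "S = {v1, v2, v3, p}" and p: "p \<notin> {v1, v2, v3}"
    and lift: "liftable F S" "F p \<ge> 2"
    and fp: "f2 p = 1" "f3 p = 1"
    and q: "q \<in> int_lattice" "q = p + t *\<^sub>R (v1 - p)" "0 < t" "t < 1"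
  shows False
proof -
  have lat: "p \<in> int_lattice" "v1 - p \<in> int_lattice"
    using lattice mem S by (auto intro: int_lattice_diff)
  have "t *\<^sub>R (v1 - p) \<in> int_lattice"
    using int_lattice_diff[OF q(1) lat(1)] q(2) by simp
  from lattice_vector_divisible[OF lat(2) this q(3,4)]
  obtain m w where m: "m \<ge> 2" and w: "w \<in> int_lattice" "v1 - p = real m *\<^sub>R w" .
  then have v1: "v1 = p + real m *\<^sub>R w"
    by (simp add: algebra_simps)
  have "w \<noteq> 0"
    using v1 p by auto
  have "p + real m *\<^sub>R w \<in> S"
    using mem(1) unfolding v1 .
  then have "p + real 1 *\<^sub>R w \<in> S"
    using lift(2) m by (intro liftableD[OF lift(1) _ lat(1) w(1), of 1 m 1]) linarith+
  then have in_S: "p + w \<in> S"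
    by simp
  have w': "p + w = (1 - 1 / real m) *\<^sub>R p + (1 / real m) *\<^sub>R v1"
    unfolding v1 using m by (simp add: algebra_simps)
  have le: "f (p + w) \<le> 1" if "affine_map f" "f p = 1" "f v1 = 0 \<or> f v1 = 1"
    for f :: "real^2 \<Rightarrow> real"
  proof -
    have "f (p + w) = (1 - 1 / real m) * f p + (1 / real m) * f v1"
      unfolding w' using affine_map_combination2[OF that(1), of "1 - 1 / real m" "1 / real m" p v1] by simp
    then show ?thesis
      using that m by auto
  qed
  have "f2 (p + w) \<le> 1" "f3 (p + w) \<le> 1"
    using le[OF affine(2) fp(1)] le[OF affine(3) fp(2)] zero_one mem distinct by auto
  then have "p + w \<noteq> v2" "p + w \<noteq> v3"
    using large by auto
  then have "p + w = v1"
    using in_S \<open>w \<noteq> 0\<close> unfolding S by auto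
  then have "w = real m *\<^sub>R w"
    unfolding v1 by simp
  then have "(real m - 1) *\<^sub>R w = 0"
    by (simp add: algebra_simps)
  then show False
    using m \<open>w \<noteq> 0\<close> by simp
qed

text \<open>The weighted mean of \<open>f3\<close> over the vertices is \<open>f3 p = 1\<close> and
  \<open>f3 v3 \<ge> 2\<close>, so \<open>f3\<close> is 0 at \<open>v1\<close> or \<open>v2\<close>.
  The integer \<open>f3 q\<close> is positive and at most 1, hence 1; thus the coefficient of that
  vertex is 0, and \<open>q\<close> lies on a ray excluded by
  \<open>four_points_ray\<close>.\<close>

lemma four_points_cone:
  assumes S: "S = {v1, v2, v3, p}" and p: "p \<notin> {v1, v2, v3}"
    and lift: "liftable F S" "F p \<ge> 2"
    and fp: "f1 p = 1" "f2 p = 1" "f3 p = 1"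
    and abc: "p = a *\<^sub>R v1 + b *\<^sub>R v2 + c *\<^sub>R v3" "a > 0" "b > 0" "c > 0" "a + b + c = 1"
    and q: "q \<in> int_lattice" "q = p + s *\<^sub>R (v1 - p) + t *\<^sub>R (v2 - p)" "s \<ge> 0" "t \<ge> 0" "s + t < 1"
  shows "q = p"
proof (rule ccontr)
  assume "q \<noteq> p"
  interpret s: three_separated S v2 v1 v3 f2 f1 f3
    by (rule swap12)
  have val: "f3 v1 = 0 \<or> f3 v1 = 1" "f3 v2 = 0 \<or> f3 v2 = 1"
    using zero_one mem distinct by auto
  have "q = (1 - s - t) *\<^sub>R p + s *\<^sub>R v1 + t *\<^sub>R v2"
    using q(2) by (simp add: algebra_simps)
  then have fq: "f3 q = (1 - s - t) + s * f3 v1 + t * f3 v2"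
    using affine_map_combination[OF affine(3), of "1 - s - t" s t p v1 v2] fp by simp
  have f3p: "1 = a * f3 v1 + b * f3 v2 + c * f3 v3"
    using affine_map_combination[OF affine(3) abc(5), of v1 v2 v3] abc(1) fp(3) by simp
  define x where "x = c * f3 v3"
  have "x \<ge> c * 2"
    unfolding x_def using abc(4) large by (intro mult_left_mono) auto
  then have not_both: "\<not> (f3 v1 = 1 \<and> f3 v2 = 1)"
    using f3p abc(4,5) unfolding x_def[symmetric] by auto
  have "f3 q > 0" "f3 q \<le> 1"
    using fq q(3-5) val by auto
  moreover have "f3 q \<in> \<int>"
    using q(1) integer_functional_Ints[OF functionals(3)] by auto
  ultimately have "f3 q = 1"
    by (auto elim!: Ints_cases)
  then consider "s = 0" | "t = 0"
    using fq val not_both q(3,4) by auto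
  then show False
  proof cases
    case 1
    then have "q = p + t *\<^sub>R (v2 - p)" "t \<noteq> 0"
      using q(2) \<open>q \<noteq> p\<close> by auto
    moreover have "S = {v2, v1, v3, p}" "p \<notin> {v2, v1, v3}"
      using S p by auto
    ultimately show False
      using s.four_points_ray[OF _ _ lift fp(1,3) q(1), of t] q 1 by auto
  next
    case 2
    then have "q = p + s *\<^sub>R (v1 - p)" "s \<noteq> 0"
      using q(2) \<open>q \<noteq> p\<close> by auto
    then show False
      using four_points_ray[OF S p lift fp(2,3) q(1), of s] q 2 by auto
  qed
qed

lemma four_points:
  assumes S: "S = {v1, v2, v3, p}" and pv: "p \<notin> {v1, v2, v3}"
    and p: "p \<in> convex hull (S - {p})"
    and lift: "liftable F S" "F p \<ge> 2"
  shows "(\<exists>T. unimodular_triangle T \<and> second_dilation_of (convex hull S) T) \<or>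
    reflexive_polygon (convex hull S) \<and> lattice_triangle (convex hull S) \<and>
    S = vertices (convex hull S) \<union> lattice_points (interior (convex hull S))"
proof -
  interpret r: three_separated S v2 v3 v1 f2 f3 f1
    by (rule rotate)
  interpret rr: three_separated S v3 v1 v2 f3 f1 f2
    by (rule r.rotate)
  have S': "S = {v2, v3, v1, p}" "S = {v3, v1, v2, p}"
    using S by auto
  have pv': "p \<notin> {v2, v3, v1}" "p \<notin> {v3, v1, v2}"
    using pv by auto
  have in_S: "p \<in> S"
    using S by auto
  have "S - {p} = {v1, v2, v3}"
    using S pv by auto
  then have pH: "p \<in> convex hull {v1, v2, v3}"
    using p by simp
  then obtain a b c where abc: "p = a *\<^sub>R v1 + b *\<^sub>R v2 + c *\<^sub>R v3" "0 \<le> a" "0 \<le> b" "0 \<le> c" "a + b + c = 1"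
    by (auto simp: convex_hull_3)
  consider "a > 0" "b > 0" "c > 0" | "a = 0" | "b = 0" | "c = 0"
    using abc by linarith
  then show ?thesis
  proof cases
    case 1
    have abc': "b + c + a = 1" "p = b *\<^sub>R v2 + c *\<^sub>R v3 + a *\<^sub>R v1"
      "c + a + b = 1" "p = c *\<^sub>R v3 + a *\<^sub>R v1 + b *\<^sub>R v2"
      using abc by (auto simp: add_ac)
    have fp: "f1 p = 1" "f2 p = 1" "f3 p = 1"
      using inner_point_values[OF in_S pv abc(1)] r.inner_point_values[OF in_S pv'(1) abc'(2)]
        rr.inner_point_values[OF in_S pv'(2) abc'(4)] 1 abc(5) abc'(1,3) by auto
    have H: "convex hull S = convex hull {v1, v2, v3}"
      using hull_redundant[OF pH] S by (simp add: insert_commute)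
    note simplex = triangle_simplex[OF not_collinear]
    have int: "interior (convex hull S) = {v. \<exists>x y z. 0 < x \<and> 0 < y \<and> 0 < z \<and> x + y + z = 1 \<and>
      x *\<^sub>R v1 + y *\<^sub>R v2 + z *\<^sub>R v3 = v}"
      unfolding H by (rule interior_convex_hull_3_minimal[OF not_collinear]) simp
    \<comment> \<open>One of the three cones at \<open>p\<close> contains \<open>q\<close>, and
      inside the triangle the bound \<open>s + t < 1\<close> is available.\<close>
    have "q = p" if q: "q \<in> int_lattice" "q \<in> interior (convex hull S)" for q
    proof -
      obtain u v w where uvw: "u + v + w = 1" "q = u *\<^sub>R v1 + v *\<^sub>R v2 + w *\<^sub>R v3" "0 < u" "0 < v" "0 < w"
        using q(2) unfolding int by blast
      obtain s t where st: "0 \<le> s" "0 \<le> t" "s + t < 1" and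
        "q = p + s *\<^sub>R (v1 - p) + t *\<^sub>R (v2 - p) \<or> q = p + s *\<^sub>R (v2 - p) + t *\<^sub>R (v3 - p) \<or>
         q = p + s *\<^sub>R (v3 - p) + t *\<^sub>R (v1 - p)"
        using barycentric_cone[OF 1 abc(5,1) uvw(1,2)] uvw(3-5) by blast
      then show ?thesis
        using four_points_cone[OF S pv lift fp abc(1) 1 abc(5) q(1) _ st]
          r.four_points_cone[OF S'(1) pv'(1) lift fp(2,3,1) abc'(2) 1(2,3,1) abc'(1) q(1) _ st]
          rr.four_points_cone[OF S'(2) pv'(2) lift fp(3,1,2) abc'(4) 1(3,1,2) abc'(3) q(1) _ st]
        by blast
    qed
    moreover have "p \<in> interior (convex hull S)"
      unfolding int using abc 1 by blast
    ultimately have lp: "lattice_points (interior (convex hull S)) = {p}"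
      using in_S lattice by (auto simp: lattice_points_def)
    have "lattice_polytope (convex hull S)"
      using finite lattice by (rule lattice_polytope_convex_hull)
    then have "lattice_polygon (convex hull S)"
      using simplex(1) by (simp add: lattice_polygon_def H)
    moreover have V: "vertices (convex hull S) = {v1, v2, v3}"
      unfolding H by (rule simplex(2))
    moreover have "S = {v1, v2, v3} \<union> {p}"
      using S by auto
    ultimately show ?thesis
      using simplex(3) lp by (simp add: reflexive_polygon_def lattice_triangle_def)
  next
    case 2
    then have "b \<noteq> 0" "c \<noteq> 0"
      using abc pv by auto
    then show ?thesis
      using r.four_points_edge[OF S'(1) pv'(1) _ _ _ _ lift, of b c] abc 2 by auto
  next
    case 3
    then have "a \<noteq> 0" "c \<noteq> 0"
      using abc pv by auto
    then show ?thesis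
      using rr.four_points_edge[OF S'(2) pv'(2) _ _ _ _ lift, of c a] abc 3 by (auto simp: add_ac)
  next
    case 4
    then have "a \<noteq> 0" "b \<noteq> 0"
      using abc pv by auto
    then show ?thesis
      using four_points_edge[OF S pv _ _ _ _ lift, of a b] abc 4 by auto
  qed
qed

end

subsection \<open>Spiked polytopes\<close>

lemma affine_map_compose:
  assumes "affine_map f" "affine_map g"
  shows "affine_map (\<lambda>x. f (g x))"
proof -
  have "linear ((\<lambda>x. f x - f 0) \<circ> (\<lambda>x. g x - g 0))"
    using assms by (intro linear_compose) (auto simp: affine_map_def)
  moreover have "f (g x - g 0) - f 0 = f (g x) - f (g 0)" for x
    using affine_map_combination[OF assms(1), of 1 "-1" 1 "g x" "g 0" 0] by simp
  ultimately show ?thesis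
    by (simp add: affine_map_def comp_def)
qed

lemma wide_projection:
  fixes \<pi> :: "real^'n \<Rightarrow> real^2"
  assumes "lattice_projection \<pi>" "wide A"
  shows "wide (\<pi> ` A)"
  unfolding wide_def
proof (intro allI impI)
  fix f :: "real^2 \<Rightarrow> real"
  assume f: "integer_functional f \<and> \<not> f constant_on UNIV"
  have \<pi>: "affine_map \<pi>" "\<pi> ` int_lattice = int_lattice"
    using assms(1) by (auto simp: lattice_projection_def)
  have "affine_map (\<lambda>x. f (\<pi> x))"
    using affine_map_compose[OF integer_functional_affine \<pi>(1)] f by blast
  moreover have "(\<lambda>x. f (\<pi> x)) ` int_lattice \<subseteq> \<int>"
    using \<pi>(2) f integer_functional_Ints by blast
  ultimately have "integer_functional (\<lambda>x. f (\<pi> x))"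
    by (simp add: integer_functional_def)
  moreover have "\<not> (\<lambda>x. f (\<pi> x)) constant_on UNIV"
  proof
    assume "(\<lambda>x. f (\<pi> x)) constant_on UNIV"
    then obtain c where c: "\<And>x. f (\<pi> x) = c"
      by (auto simp: constant_on_def)
    \<comment> \<open>\<open>\<pi>\<close> is onto the lattice, and three lattice points determine
      an affine functional on the plane.\<close>
    have fc: "f y = c" if "y \<in> int_lattice" for y
      using that c \<pi>(2) by (metis imageE)
    obtain s t d where st: "f = (\<lambda>x. s * x $ 1 + t * x $ 2 + d)"
      using integer_functional_2E f by blast
    have "s = 0" "t = 0"
      using fc[of 0] fc[of "vector [1, 0]"] fc[of "vector [0, 1]"] by (auto simp: st int_lattice_2)
    then have "f constant_on UNIV"
      by (auto simp: st constant_on_def)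
    then show False
      using f by simp
  qed
  ultimately show "\<exists>x\<in>\<pi> ` A. \<exists>y\<in>\<pi> ` A. f y - f x > 1"
    using assms(2) unfolding wide_def by (simp add: image_iff)
qed

section \<open>Vertices of lattice polytopes and of finite configurations\<close>

lemma lattice_polytope_hull_lattice_points:
  assumes "lattice_polytope P"
  shows "convex hull (lattice_points P) = P"
proof -
  have P: "polytope P" "vertices P \<subseteq> int_lattice"
    using assms by (auto simp: lattice_polytope_def)
  then have "convex hull (vertices P) = P"
    using Krein_Milman_Minkowski[of P] by (simp add: vertices_def polytope_imp_compact polytope_imp_convex)
  moreover have "vertices P \<subseteq> lattice_points P"
    using P by (auto simp: vertices_def lattice_points_def extreme_point_of_def)
  then have "convex hull (vertices P) \<subseteq> convex hull (lattice_points P)"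
    by (rule hull_mono)
  moreover have "convex hull (lattice_points P) \<subseteq> P"
    using P by (intro hull_minimal) (auto simp: lattice_points_def polytope_imp_convex)
  ultimately show ?thesis
    by auto
qed

lemma three_essential_vertices:
  fixes P :: "(real^3) set"
  assumes "quasi_minimal_polytope P" "aff_dim P = 3"
  shows "card (essential_vertices (lattice_points P)) \<ge> 3"
proof -
  let ?A = "lattice_points P"
  have P: "lattice_polytope P" and A: "finite ?A" "card (vertices P - essential_vertices ?A) \<le> 1"
    using assms(1) lattice_polytope_hull_lattice_points[of P]
    by (auto simp: quasi_minimal_polytope_def quasi_minimal_def)
  have V: "vertices P \<subseteq> ?A"
    using P by (auto simp: vertices_def lattice_points_def extreme_point_of_def lattice_polytope_def)
  then have fin: "finite (vertices P)"
    using A(1) finite_subset by blast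
  have "convex hull (vertices P) = P"
    using P Krein_Milman_Minkowski[of P]
    by (simp add: vertices_def lattice_polytope_def polytope_imp_compact polytope_imp_convex)
  then have "aff_dim (vertices P) = 3"
    using assms(2) by (metis aff_dim_convex_hull)
  then have "card (vertices P) \<ge> 4"
    using aff_dim_le_card[OF fin] by simp
  moreover have "essential_vertices ?A \<subseteq> vertices P"
    using lattice_polytope_hull_lattice_points[OF P] by (auto simp: essential_vertices_def)
  then have "card (vertices P - essential_vertices ?A) = card (vertices P) - card (essential_vertices ?A)"
    using fin finite_subset by (intro card_Diff_subset) auto
  ultimately show ?thesis
    using A(2) by linarith
qed

lemma not_vertex_in_hull:
  assumes "finite S" "x \<in> S" "x \<notin> vertices (convex hull S)"
  shows "x \<in> convex hull (S - {x})"
proof (rule ccontr)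
  assume "x \<notin> convex hull (S - {x})"
  then have "x extreme_point_of convex hull insert x (S - {x})"
    using assms(1) by (intro extreme_point_of_convex_hull_insert) auto
  then show False
    using assms(2,3) by (simp add: vertices_def insert_absorb)
qed

theorem theorem6:
  fixes P :: "(real^3) set" and A' P' :: "(real^2) set"
  assumes "lattice_polytope P"
    and "aff_dim P = 3"
    and "size_of P \<ge> 7"
    and "aff_dim A' = 2"
    and "spiked_wrt P A'"
    and "P' = convex hull A'"
  shows "(\<exists>T. unimodular_triangle T \<and> second_dilation_of P' T) \<or>
    (reflexive_polygon P' \<and> lattice_triangle P' \<and>
      A' = vertices P' \<union> lattice_points (interior P')) \<or>
    (A' = lattice_points P' \<and>
      card (lattice_points (frontier P')) = 4 \<and>
      card (lattice_points (interior P')) = 1)"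
proof -
  define A where "A = lattice_points P"
  obtain \<pi> where qm: "quasi_minimal_polytope P" and \<pi>: "lattice_projection \<pi>" and A': "A' = \<pi> ` A"
    and unique: "\<forall>v\<in>vertices (convex hull A'). \<exists>!x. x \<in> A \<and> \<pi> x = v"
    and bij: "bij_betw \<pi> (essential_vertices A) (essential_vertices A')"
    using assms(5) by (auto simp: spiked_wrt_def A_def)
  have A: "finite A" "A \<subseteq> int_lattice" "width (convex hull A) > 1"
    using qm by (auto simp: quasi_minimal_polytope_def quasi_minimal_def A_def)
  have fin: "finite A'" and lat: "A' \<subseteq> int_lattice"
    using A \<pi> by (auto simp: A' lattice_projection_def)
  have wide: "wide A'"
    unfolding A' using wide_projection[OF \<pi> wide_if_width_gt_1] A by blast
  have "card (essential_vertices A') \<ge> 3"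
    using three_essential_vertices[OF qm assms(2)] bij_betw_same_card[OF bij] by (simp add: A_def)
  then obtain V where V: "V \<subseteq> essential_vertices A'" "card V = 3"
    by (meson obtain_subset_with_card_n)
  then obtain v1 v2 v3 where v: "V = {v1, v2, v3}" "v1 \<noteq> v2" "v1 \<noteq> v3" "v2 \<noteq> v3"
    by (auto simp: card_3_iff)
  have ess: "v1 \<in> essential_vertices A'" "v2 \<in> essential_vertices A'" "v3 \<in> essential_vertices A'"
    using V v by auto
  have vert: "essential_vertices A' \<subseteq> vertices (convex hull A')"
    by (auto simp: essential_vertices_def)
  moreover have "vertices (convex hull A') \<subseteq> A'"
    using extreme_point_of_convex_hull by (auto simp: vertices_def)
  ultimately have mem: "v1 \<in> A'" "v2 \<in> A'" "v3 \<in> A'"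
    using ess by auto
  have ne: "A' - {v1} \<noteq> {}" "A' - {v2} \<noteq> {}" "A' - {v3} \<noteq> {}"
    using mem v by auto
  obtain f1 where f1: "separates f1 v1 A'"
    by (rule essential_vertex_separates[OF fin lat wide ess(1) ne(1)])
  obtain f2 where f2: "separates f2 v2 A'"
    by (rule essential_vertex_separates[OF fin lat wide ess(2) ne(2)])
  obtain f3 where f3: "separates f3 v3 A'"
    by (rule essential_vertex_separates[OF fin lat wide ess(3) ne(3)])
  interpret three_separated A' v1 v2 v3 f1 f2 f3
    by (rule three_separated.intro) (fact fin lat wide mem v f1 f2 f3)+
  define F where "F x = card {y \<in> A. \<pi> y = x}" for x
  have lift: "liftable F A'"
  proof -
    have "convex P"
      using assms(1) by (simp add: lattice_polytope_def polytope_imp_convex)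
    then show ?thesis
      unfolding liftable_def A' F_def A_def
      by (intro allI impI) (rule lift_lattice_point[OF _ A(1)[unfolded A_def] \<pi>]; assumption)
  qed
  have F_vertex: "F x = 1" if "x \<in> vertices (convex hull A')" for x
  proof -
    have "\<exists>!y. y \<in> A \<and> \<pi> y = x"
      using unique that by (rule bspec)
    then obtain y where "(y \<in> A \<and> \<pi> y = x) \<and> (\<forall>z. z \<in> A \<and> \<pi> z = x \<longrightarrow> z = y)"
      unfolding Ex1_def ..
    then have "{z \<in> A. \<pi> z = x} = {y}"
      by blast
    then show ?thesis
      by (simp add: F_def)
  qed
  have "card A = (\<Sum>x\<in>A'. F x)"
    unfolding A' F_def using sum.image_gen[OF A(1), of "\<lambda>_. 1::nat" \<pi>] by simp
  then have "(\<Sum>x\<in>A'. F x) \<ge> 7"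
    using assms(3) by (simp add: size_of_def A_def)
  moreover have "(\<Sum>x\<in>A'. F x) = (\<Sum>x\<in>{v1, v2, v3}. F x) + (\<Sum>x\<in>A' - {v1, v2, v3}. F x)"
    using mem fin by (intro sum.subset_diff[THEN trans[OF _ add.commute]]) auto
  moreover have "F v1 = 1" "F v2 = 1" "F v3 = 1"
    using F_vertex ess vert by auto
  \<comment> \<open>The three chosen vertices have single fibres and use up only three of at least
    seven lattice points.\<close>
  ultimately have F_sum: "(\<Sum>x\<in>A' - {v1, v2, v3}. F x) \<ge> 4"
    using v by simp
  consider "card (A' - {v1, v2, v3}) \<ge> 3" | "card (A' - {v1, v2, v3}) = 2"
    | "card (A' - {v1, v2, v3}) = 1" | "card (A' - {v1, v2, v3}) = 0"
    by linarith
  then show ?thesis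
  proof cases
    case 1
    then show ?thesis
      using six_points assms(6) by blast
  next
    case 2
    then obtain p q where pq: "A' - {v1, v2, v3} = {p, q}" "p \<noteq> q"
      by (auto simp: card_2_iff)
    then have S: "A' = {v1, v2, v3, p, q}" "A' = {v1, v2, v3, q, p}" and F4: "F p + F q \<ge> 4" "F q + F p \<ge> 4"
      and npq: "p \<notin> {v1, v2, v3}" "q \<notin> {v1, v2, v3}"
      using mem F_sum by auto
    \<comment> \<open>Two vertices would contribute only 2. Either point may be the non-vertex,
      hence the two orderings of \<open>p\<close> and \<open>q\<close>.\<close>
    have "p \<notin> vertices (convex hull A') \<or> q \<notin> vertices (convex hull A')"
      using F_vertex[of p] F_vertex[of q] F4 by auto
    then have "p \<in> convex hull (A' - {p}) \<or> q \<in> convex hull (A' - {q})"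
      using not_vertex_in_hull[OF fin] S by blast
    then show ?thesis
      using five_points[OF S(1) npq pq(2) _ lift F4(1)] five_points[OF S(2) npq(2,1) _ _ lift F4(2)] pq(2)
      unfolding assms(6) by blast
  next
    case 3
    then obtain p where p: "A' - {v1, v2, v3} = {p}"
      by (auto simp: card_1_singleton_iff)
    then have S: "A' = {v1, v2, v3, p}" and F4: "F p \<ge> 4" and np: "p \<notin> {v1, v2, v3}"
      using mem F_sum by auto
    have "p \<notin> vertices (convex hull A')"
      using F_vertex[of p] F4 by auto
    then have "p \<in> convex hull (A' - {p})"
      using not_vertex_in_hull[OF fin] S by blast
    then show ?thesis
      using four_points[OF S np _ lift] F4 unfolding assms(6) by auto
  next
    case 4
    then have "A' - {v1, v2, v3} = {}"
      using fin by simp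
    then show ?thesis
      using F_sum by (simp only: sum.empty)
  qed
qed

end
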